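(* Let $2<\alpha<3$. Assume that $\mathbf P(X_1=t)=t^{-\alpha}L_1(t)$ for $t=1,2,\dots$, where $L_1$ is slowly varying at infinity and satisfies $$L_1\bigl(tL_1^{1/(\alpha-1)}(t)\bigr)\sim L_1(t).$$ Suppose that $\mu>0$, that $\mathbf P(X_1<-t)=O\bigl(\mathbf P(X_1>t)\bigr)$, and that $\mathbf P(N=t)=o\bigl(\mathbf P(X_1=t)\bigr)$ as $t\to+\infty$. Then, as $t\to+\infty$ through the integers, $$\mathbf P(S_N=t)\sim(\mathbf E N)\,\mathbf P(X_1=t).$$
   Context: $X_1,X_2,\dots$ are i.i.d. integer valued random variables (not necessarily non-negative); $N$ is a non-negative integer valued random variable independent of $\{X_i\}$; $S_N=X_1+\dots+X_N$ (with $S_0=0$). $\mu=\mathbf E X_1$. $f(t)\sim g(t)$ means $f(t)/g(t)\to1$ as $t\to+\infty$. *)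

theory Defs
  imports "HOL-Probability.Probability" "HOL-Library.Landau_Symbols"
begin

text \<open>
  Slow variation at infinity in the sense of Karamata. As usual, measurability and positivity
  are required on some neighbourhood of infinity only.
\<close>
definition slowly_varying :: "(real \<Rightarrow> real) \<Rightarrow> bool" where
  "slowly_varying L \<longleftrightarrow>
     (\<exists>a. L \<in> borel_measurable (restrict_space borel {a..}) \<and> (\<forall>x\<ge>a. L x > 0)) \<and>
     (\<forall>c>0. ((\<lambda>x. L (c * x) / L x) \<longlongrightarrow> 1) at_top)"

context prob_space
begin

text \<open>The index 0 plays the role of the customary first index 1: the sequence is
  \<open>X 0, X 1, \<dots>\<close>.\<close>
definition iid_int_seq :: "(nat \<Rightarrow> 'a \<Rightarrow> int) \<Rightarrow> bool" where
  "iid_int_seq X \<longleftrightarrow>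
     indep_vars (\<lambda>_. count_space UNIV) X UNIV \<and>
     (\<forall>i. distr M (count_space UNIV) (X i) = distr M (count_space UNIV) (X 0))"

text \<open>
  Independence of \<open>N\<close> and the whole sequence, i.e. of the generated sigma-algebras. The constant
  \<open>indep_var\<close> is not applicable since it needs both variables to have the same value type.
\<close>
definition indep_of_int_seq :: "('a \<Rightarrow> nat) \<Rightarrow> (nat \<Rightarrow> 'a \<Rightarrow> int) \<Rightarrow> bool" where
  "indep_of_int_seq N X \<longleftrightarrow>
     indep_set
       (sets (vimage_algebra (space M) N (count_space UNIV)))
       (sets (vimage_algebra (space M) (\<lambda>\<omega> i. X i \<omega>) (\<Pi>\<^sub>M i\<in>UNIV. count_space UNIV)))"

end

definition random_sum :: "(nat \<Rightarrow> 'a \<Rightarrow> int) \<Rightarrow> ('a \<Rightarrow> nat) \<Rightarrow> 'a \<Rightarrow> int" where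
  "random_sum X N \<omega> = (\<Sum>i<N \<omega>. X i \<omega>)"

end

theory Submission
  imports Defs
begin

text \<open>
  Write \<open>p(t) = P(X\<^sub>1 = t)\<close> and condition on \<open>N\<close>, so that
  \<open>P(S\<^sub>N = t) = \<Sum>n. P(N = n) P(S\<^sub>n = t)\<close>; the range of \<open>n\<close> is cut at \<open>\<epsilon> t\<close>.

  For \<open>n \<le> \<epsilon> t\<close> one has \<open>P(S\<^sub>n = t) \<le> C n p(t)\<close>: either one jump exceeds \<open>\<delta> t\<close>, which costs at
  most \<open>n sup {p(m) | m > \<delta> t}\<close>, or all jumps are truncated at \<open>\<delta> t\<close> and a Chernoff bound with
  exponent of order \<open>ln t / t\<close> beats every fixed power of \<open>t\<close>. Since \<open>P(S\<^sub>n = t) \<sim> n p(t)\<close> for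
  fixed \<open>n\<close> and \<open>E N < \<infinity>\<close>, dominated convergence yields \<open>(E N) p(t)\<close>.

  For \<open>n > \<epsilon> t\<close> it is enough that \<open>P(N = n)\<close> is uniformly \<open>o(p(t))\<close> and that the Green function
  \<open>\<Sum>n. P(S\<^sub>n = t)\<close> is bounded in \<open>t\<close>. By the maximum principle it is largest at 0, and it is finite
  there because for positive drift \<open>x \<mapsto> min 1 ((A / x)\<^sup>k)\<close> is superharmonic for large \<open>A\<close>.
\<close>

section \<open>Slowly and regularly varying functions\<close>

lemma lborel_integral_translate:
  fixes g :: "real \<Rightarrow> real"
  shows "(\<integral>v. g (v - w) \<partial>lborel) = (\<integral>v. g v \<partial>lborel)"
  using lborel_integral_real_affine[of 1 g "-w"] by (simp add: algebra_simps)

text \<open>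
  Uniform convergence theorem in additive form: \<open>\<bar>f (x + w) - f x\<bar>\<close> is at most
  \<open>\<bar>f (x + v) - f x\<bar> + \<bar>f (x + w + (v - w)) - f (x + w)\<bar>\<close>; averaging over \<open>v \<in> [1, 2]\<close>, both terms
  vanish by dominated convergence even when \<open>w\<close> varies with \<open>x\<close>.
\<close>
lemma uniform_increments:
  fixes f :: "real \<Rightarrow> real"
  assumes [measurable]: "f \<in> borel_measurable borel"
    and lim: "\<And>u. ((\<lambda>x. f (x + u) - f x) \<longlongrightarrow> 0) at_top"
    and e: "e > 0"
  shows "\<forall>\<^sub>F x in at_top. \<forall>u\<in>{0..1}. \<bar>f (x + u) - f x\<bar> < e"
proof (rule ccontr)
  assume "\<not> ?thesis"
  then have "\<forall>m::nat. \<exists>x u. real m \<le> x \<and> u \<in> {0..1} \<and> e \<le> \<bar>f (x + u) - f x\<bar>"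
    unfolding eventually_at_top_linorder by (meson not_less)
  then obtain x w where xw: "\<And>m::nat. real m \<le> x m" "\<And>m. w m \<in> {0..1}"
      "\<And>m. e \<le> \<bar>f (x m + w m) - f (x m)\<bar>"
    by metis
  have vanish: "(\<lambda>m. \<integral>v. indicator {0..2} v * min 1 \<bar>f (y m + v) - f (y m)\<bar> \<partial>lborel) \<longlonglongrightarrow> 0"
    if y: "\<And>m::nat. real m \<le> y m" for y
  proof -
    have ytop: "filterlim y at_top sequentially"
      by (rule filterlim_at_top_mono[OF filterlim_real_sequentially]) (use y in auto)
    have "(\<lambda>m. \<integral>v. indicator {0..2} v * min 1 \<bar>f (y m + v) - f (y m)\<bar> \<partial>lborel)
            \<longlonglongrightarrow> (\<integral>v. 0 \<partial>(lborel :: real measure))"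
    proof (rule integral_dominated_convergence[where w = "indicator {0..2}"])
      show "AE v in lborel. (\<lambda>m. indicator {0..2} v * min 1 \<bar>f (y m + v) - f (y m)\<bar>) \<longlonglongrightarrow> 0"
      proof (rule AE_I2)
        fix v :: real
        have "(\<lambda>m. f (y m + v) - f (y m)) \<longlonglongrightarrow> 0"
          using filterlim_compose[OF lim ytop] .
        then have "(\<lambda>m. indicator {0..2} v * min 1 \<bar>f (y m + v) - f (y m)\<bar>) \<longlonglongrightarrow> indicator {0..2} v * min 1 \<bar>0::real\<bar>"
          by (intro tendsto_intros)
        then show "(\<lambda>m. indicator {0..2} v * min 1 \<bar>f (y m + v) - f (y m)\<bar>) \<longlonglongrightarrow> 0" by simp
      qed
    qed (auto simp: indicator_def)
    then show ?thesis by simp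
  qed
  have int: "integrable lborel (\<lambda>v. indicator {0..2} v * min 1 \<bar>f (y + v) - f y\<bar>)" for y
    by (rule Bochner_Integration.integrable_bound[where f = "indicator {0..2} :: real \<Rightarrow> real"])
      (auto simp: indicator_def)
  let ?G = "\<lambda>y v. indicator {0..2} v * min 1 \<bar>f (y + v) - f y\<bar>"
  \<comment> \<open>For \<open>v\<close> in \<open>[1, 2]\<close> both \<open>v\<close> and
    \<open>v - w m\<close> lie in \<open>[0, 2]\<close>, the window of \<open>?G\<close>. The cap
    \<open>min 1\<close> supplies the dominating function and still obeys the triangle
    inequality.\<close>
  have bound: "min 1 e \<le> (\<integral>v. ?G (x m) v \<partial>lborel) + (\<integral>v. ?G (x m + w m) v \<partial>lborel)" for m
  proof -
    have int': "integrable lborel (\<lambda>v. ?G (x m + w m) (v - w m))"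
      using lborel_integrable_real_affine[OF int[of "x m + w m"], of 1 "- w m"] by (simp add: algebra_simps)
    have "min 1 e = (\<integral>v. indicator {1..2::real} v * min 1 e \<partial>lborel)"
      by simp
    also have "\<dots> \<le> (\<integral>v. ?G (x m) v + ?G (x m + w m) (v - w m) \<partial>lborel)"
    proof (rule integral_mono)
      show "integrable lborel (\<lambda>v. ?G (x m) v + ?G (x m + w m) (v - w m))"
        using int int' by (intro Bochner_Integration.integrable_add) 
    next
      fix v :: real
      have "x m + w m + (v - w m) = x m + v" by simp
      then show "indicator {1..2} v * min 1 e \<le> ?G (x m) v + ?G (x m + w m) (v - w m)"
        using xw(2,3)[of m] by (auto simp: indicator_def)
    qed simp
    also have "\<dots> = (\<integral>v. ?G (x m) v \<partial>lborel) + (\<integral>v. ?G (x m + w m) (v - w m) \<partial>lborel)"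
      using int int' by (intro Bochner_Integration.integral_add)
    finally show ?thesis
      by (subst (asm) lborel_integral_translate[where g = "?G (x m + w m)"])
  qed
  have "(\<lambda>m. (\<integral>v. ?G (x m) v \<partial>lborel) + (\<integral>v. ?G (x m + w m) v \<partial>lborel)) \<longlonglongrightarrow> 0 + 0"
  proof (intro tendsto_add vanish)
    show "real m \<le> x m + w m" for m using xw(1,2)[of m] by auto
  qed (rule xw)
  then have "min 1 e \<le> 0 + 0"
    by (rule LIMSEQ_le_const) (use bound in blast)
  with e show False by simp
qed

text \<open>Telescoping over unit steps from \<open>x\<close> towards \<open>y\<close>; the
  \<open>+ 1\<close> pays for the last step, which may be shorter.\<close>

lemma increments_linear_bound:
  fixes f :: "real \<Rightarrow> real"
  assumes "\<And>x u. x \<ge> x0 \<Longrightarrow> u \<in> {0..1} \<Longrightarrow> \<bar>f (x + u) - f x\<bar> \<le> e" and "x0 \<le> x" "x \<le> y" "0 \<le> e"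
  shows "\<bar>f y - f x\<bar> \<le> e * (y - x + 1)"
proof -
  have "\<bar>f y - f x\<bar> \<le> e * (y - x + 1)" if "nat \<lfloor>y - x\<rfloor> = n" "x0 \<le> x" "x \<le> y" for n x
    using that
  proof (induction n arbitrary: x)
    case 0
    then have "y - x \<in> {0..1}" by (auto simp: nat_eq_iff2)
    then have "\<bar>f (x + (y - x)) - f x\<bar> \<le> e" using 0 by (intro assms)
    moreover have "e * 1 \<le> e * (y - x + 1)" using 0 assms by (intro mult_left_mono) auto
    ultimately show ?case by simp
  next
    case (Suc n)
    then have *: "x + 1 \<le> y" by linarith
    have "nat \<lfloor>y - (x + 1)\<rfloor> = n" using Suc(2) by linarith
    then have "\<bar>f y - f (x + 1)\<bar> \<le> e * (y - (x + 1) + 1)" using Suc * by (intro Suc.IH) auto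
    moreover have "\<bar>f (x + 1) - f x\<bar> \<le> e" using Suc by (intro assms) auto
    ultimately show ?case by (simp add: algebra_simps)
  qed
  then show ?thesis using assms by blast
qed

text \<open>In logarithmic coordinates, \<open>f = ln o L o exp\<close>, slow variation says that
  \<open>f (x + u) - f x\<close> vanishes. Uniformity over \<open>u\<close> in \<open>[0, 1]\<close>
  is the second claim. Summed over unit steps it gives the first, Potter's bound: the slope
  \<open>e\<close> becomes the power, the extra unit the factor \<open>exp e\<close>.\<close>

lemma slowly_varying_potter:
  assumes "slowly_varying L" "e > 0"
  shows "\<exists>x0>0. \<forall>x\<ge>x0. \<forall>y\<ge>x. L x > 0 \<and> L y \<le> exp e * (y / x) powr e * L x
                    \<and> L x \<le> exp e * (y / x) powr e * L y"
    and "\<forall>\<^sub>F x in at_top. \<forall>y\<in>{x..exp 1 * x}. \<bar>ln (L y) - ln (L x)\<bar> < e"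
proof -
  from assms obtain a where meas: "L \<in> borel_measurable (restrict_space borel {a..})"
    and pos: "\<And>x. x \<ge> a \<Longrightarrow> L x > 0" and lim: "\<And>c. c > 0 \<Longrightarrow> ((\<lambda>x. L (c * x) / L x) \<longlongrightarrow> 1) at_top"
    unfolding slowly_varying_def by auto
  \<comment> \<open>Clamping at \<open>a\<close> makes \<open>f\<close> measurable on the whole line
    and changes nothing once \<open>exp x\<close> exceeds \<open>a\<close>.\<close>
  define f where "f x = ln (L (max a (exp x)))" for x
  have *: "(\<lambda>x. max a (exp x)) \<in> borel \<rightarrow>\<^sub>M restrict_space borel {a..}"
    by (intro measurable_restrict_space2) auto
  have f[measurable]: "f \<in> borel_measurable borel"
    unfolding f_def using measurable_compose[OF * meas] by simp
  have exptop: "\<forall>\<^sub>F x in at_top. exp x \<ge> max a (max 1 b)" for b :: real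
    using filterlim_at_top exp_at_top by blast
  have flim: "((\<lambda>x. f (x + u) - f x) \<longlongrightarrow> 0) at_top" for u
  proof -
    have "((\<lambda>x. ln (L (exp u * exp x) / L (exp x))) \<longlongrightarrow> ln 1) at_top"
      by (intro tendsto_ln filterlim_compose[OF lim exp_at_top]) auto
    moreover have "\<forall>\<^sub>F x in at_top. ln (L (exp u * exp x) / L (exp x)) = f (x + u) - f x"
      using exptop[of 0] exptop[of "a / exp u"]
    proof eventually_elim
      case (elim x)
      then have "exp u * exp x \<ge> a" by (simp add: field_simps)
      then show ?case using elim pos[of "exp x"] pos[of "exp u * exp x"]
        by (simp add: f_def ln_div exp_add algebra_simps max_absorb2)
    qed
    ultimately show ?thesis by (simp add: tendsto_cong)
  qed
  have ev: "\<forall>\<^sub>F x in at_top. \<forall>u\<in>{0..1}. \<bar>f (x + u) - f x\<bar> < e"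
    by (rule uniform_increments[OF f flim \<open>e > 0\<close>])
  then obtain x1 where x1: "\<And>x u. x \<ge> x1 \<Longrightarrow> u \<in> {0..1} \<Longrightarrow> \<bar>f (x + u) - f x\<bar> < e"
    unfolding eventually_at_top_linorder by blast
  define x0 where "x0 = max (exp x1) (max a 1)"
  have fL: "f (ln x) = ln (L x)" if "x \<ge> x0" for x
    using that by (simp add: f_def x0_def max_absorb2)
  have x0: "ln x \<ge> x1" "x \<ge> a" "x > 0" if "x \<ge> x0" for x
    using that by (auto simp: x0_def ln_ge_iff)
  have L: "L x > 0 \<and> L y \<le> exp e * (y / x) powr e * L x
                    \<and> L x \<le> exp e * (y / x) powr e * L y" if "x \<ge> x0" "y \<ge> x" for x y
  proof -
    have xy: "0 < x" "0 < y" "L x > 0" "L y > 0" using x0 that pos by (auto intro: order_trans)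
    have "\<bar>f (ln y) - f (ln x)\<bar> \<le> e * (ln y - ln x + 1)"
      by (rule increments_linear_bound[of x1 f e "ln x" "ln y"])
        (use x1 x0[of x] that xy \<open>e > 0\<close> in \<open>auto intro: less_imp_le\<close>)
    then have *: "\<bar>ln (L y) - ln (L x)\<bar> \<le> e * (ln y - ln x + 1)"
      using fL that by simp
    have eq: "exp e * (y / x) powr e * z = exp (ln z + e * (ln y - ln x + 1))" if "z > 0" for z
      using xy that by (simp add: powr_def ln_div exp_add exp_diff algebra_simps)
    have "L y = exp (ln (L y))" "L x = exp (ln (L x))" using xy by auto
    moreover have "exp (ln (L y)) \<le> exp (ln (L x) + e * (ln y - ln x + 1))"
       "exp (ln (L x)) \<le> exp (ln (L y) + e * (ln y - ln x + 1))"
      unfolding exp_le_cancel_iff using * by linarith+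
    ultimately show ?thesis using eq[OF xy(3)] eq[OF xy(4)] xy by simp
  qed
  have "x0 > 0" by (auto simp: x0_def)
  with L show "\<exists>x0>0. \<forall>x\<ge>x0. \<forall>y\<ge>x. L x > 0 \<and> L y \<le> exp e * (y / x) powr e * L x
                    \<and> L x \<le> exp e * (y / x) powr e * L y" by blast
  show "\<forall>\<^sub>F x in at_top. \<forall>y\<in>{x..exp 1 * x}. \<bar>ln (L y) - ln (L x)\<bar> < e"
    using eventually_ge_at_top[of x0]
  proof eventually_elim
    case (elim x)
    show ?case
    proof
      fix y assume y: "y \<in> {x..exp 1 * x}"
      have xy: "0 < x" "0 < y" using x0[OF elim] y by auto
      have "ln y \<le> ln (exp 1 * x)" using y xy by (subst ln_le_cancel_iff) auto
      then have "ln y - ln x \<in> {0..1}" using xy y by (auto simp: ln_mult)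
      from x1[OF _ this, of "ln x"] x0[OF elim] show "\<bar>ln (L y) - ln (L x)\<bar> < e"
        using fL elim y by simp
    qed
  qed
qed

text \<open>For large \<open>t\<close> the points \<open>t\<close> and \<open>t - k\<close> differ
  by a factor of at most 2, which is below \<open>exp 1\<close>. So one lies in the multiplicative
  window above the other, the order depending on the sign of \<open>k\<close>. The truncation by
  \<open>nat\<close> is then inactive.\<close>

lemma slowly_varying_tendsto_shift:
  assumes "slowly_varying L"
  shows "(\<lambda>t::nat. L (real (nat (int t - k))) / L (real t)) \<longlonglongrightarrow> 1"
proof -
  from slowly_varying_potter(1)[OF assms zero_less_one] obtain x0
    where x0: "\<And>x. x \<ge> x0 \<Longrightarrow> L x > 0" by blast
  define N where "N t = nat (int t - k)" for t :: nat
  have natlim: "filterlim (\<lambda>t. real (N t)) at_top sequentially"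
    unfolding filterlim_at_top
  proof
    fix z :: real
    show "\<forall>\<^sub>F t in sequentially. z \<le> real (N t)"
      using eventually_ge_at_top[of "nat \<lceil>z\<rceil> + nat \<bar>k\<bar>"]
      unfolding N_def by eventually_elim linarith
  qed
  have "(\<lambda>t. ln (L (real (N t))) - ln (L (real t))) \<longlonglongrightarrow> 0"
  proof (rule LIMSEQ_I)
    fix e :: real assume e: "e > 0"
    note ev = slowly_varying_potter(2)[OF assms e]
    have "\<forall>\<^sub>F t in sequentially. norm (ln (L (real (N t))) - ln (L (real t)) - 0) < e"
      using eventually_compose_filterlim[OF ev natlim] eventually_compose_filterlim[OF ev filterlim_real_sequentially]
        eventually_ge_at_top[of "3 * nat \<bar>k\<bar> + 1"]
    proof eventually_elim
      case (elim t)
      have e2: "2 \<le> exp (1::real)" using exp_ge_add_one_self[of 1] by simp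
      have close: "real t \<le> 2 * real (N t)" "real (N t) \<le> 2 * real t"
        using elim(3) unfolding N_def by linarith+
      have "2 * real t \<le> exp 1 * real t" "2 * real (N t) \<le> exp 1 * real (N t)"
        using e2 by (auto intro!: mult_right_mono)
      then have "real (N t) \<in> {real t..exp 1 * real t} \<or> real t \<in> {real (N t)..exp 1 * real (N t)}"
        using close by auto
      then show ?case
      proof
        assume "real (N t) \<in> {real t..exp 1 * real t}"
        from bspec[OF elim(2) this] show ?thesis by simp
      next
        assume "real t \<in> {real (N t)..exp 1 * real (N t)}"
        from bspec[OF elim(1) this] show ?thesis by (simp only: abs_minus_commute real_norm_def diff_0_right)
      qed
    qed
    then show "\<exists>no. \<forall>t\<ge>no. norm (ln (L (real (N t))) - ln (L (real t)) - 0) < e"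
      unfolding eventually_sequentially .
  qed
  then have "(\<lambda>t. exp (ln (L (real (N t))) - ln (L (real t)))) \<longlonglongrightarrow> exp 0"
    by (rule tendsto_exp)
  moreover have "\<forall>\<^sub>F t in sequentially. exp (ln (L (real (N t))) - ln (L (real t))) = L (real (N t)) / L (real t)"
    using eventually_compose_filterlim[OF eventually_ge_at_top[of x0] natlim]
      eventually_compose_filterlim[OF eventually_ge_at_top[of x0] filterlim_real_sequentially]
    by eventually_elim (simp add: exp_diff x0)
  ultimately have "(\<lambda>t. L (real (N t)) / L (real t)) \<longlonglongrightarrow> exp 0"
    by (rule Lim_transform_eventually)
  then show ?thesis by (simp add: N_def)
qed

section \<open>Regularly varying sequences\<close>

context
  fixes p :: "nat \<Rightarrow> real" and L :: "real \<Rightarrow> real" and \<alpha> :: real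
  assumes L: "slowly_varying L" and p: "\<And>t. t \<ge> 1 \<Longrightarrow> p t = real t powr - \<alpha> * L (real t)"
begin

lemma regularly_varying_pos: "\<forall>\<^sub>F t in sequentially. 0 < p t"
proof -
  from slowly_varying_potter(1)[OF L zero_less_one] obtain x0
    where x0: "\<And>x. x \<ge> x0 \<Longrightarrow> L x > 0" by blast
  show ?thesis
    using eventually_ge_at_top[of "Suc (nat \<lceil>x0\<rceil>)"]
  proof eventually_elim
    case (elim t)
    then have "L (real t) > 0" by (intro x0) linarith
    then show ?case using elim by (simp add: p)
  qed
qed

lemma regularly_varying_tendsto_shift: "(\<lambda>t. p (nat (int t - k)) / p t) \<longlonglongrightarrow> 1"
proof -
  have "(\<lambda>t::nat. 1 - real_of_int k / real t) \<longlonglongrightarrow> 1 - 0"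
    by (intro tendsto_diff tendsto_const lim_const_over_n)
  then have "(\<lambda>t::nat. (1 - real_of_int k / real t) powr - \<alpha>) \<longlonglongrightarrow> (1 - 0) powr - \<alpha>"
    by (rule tendsto_powr) auto
  from tendsto_mult[OF this slowly_varying_tendsto_shift[OF L]]
  have "(\<lambda>t::nat. (1 - real_of_int k / real t) powr - \<alpha> * (L (real (nat (int t - k))) / L (real t))) \<longlonglongrightarrow> 1"
    by simp
  moreover have "\<forall>\<^sub>F t in sequentially. (1 - real_of_int k / real t) powr - \<alpha> * (L (real (nat (int t - k))) / L (real t))
       = p (nat (int t - k)) / p t"
    using eventually_ge_at_top[of "nat \<bar>k\<bar> + 1"]
  proof eventually_elim
    case (elim t)
    then have *: "nat (int t - k) \<ge> 1" "t \<ge> 1" by linarith+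
    have "1 - real_of_int k / real t = real (nat (int t - k)) / real t"
      using * by (simp add: field_simps)
    then show ?case using * by (simp add: p powr_divide)
  qed
  ultimately show ?thesis by (rule Lim_transform_eventually)
qed

text \<open>Potter's bound with exponent 1. For \<open>m >= t\<close> the ratio
  \<open>p m / p t\<close> is at most \<open>exp 1\<close> times \<open>m / t\<close> to the power
  \<open>1 - \<alpha>\<close>, which is not positive. For \<open>m < t\<close> the power is
  \<open>- (\<alpha> + 1)\<close>, and \<open>m / t\<close> stays above \<delta>.\<close>

lemma regularly_varying_almost_decreasing:
  assumes \<delta>: "\<delta> > 0" and \<alpha>: "\<alpha> \<ge> 1"
  shows "\<exists>C. \<forall>\<^sub>F t in sequentially. \<forall>m. \<delta> * real t \<le> real m \<longrightarrow> p m \<le> C * p t"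
proof -
  from slowly_varying_potter(1)[OF L zero_less_one] obtain x0 where potter: "x0 > 0"
      "\<forall>x\<ge>x0. \<forall>y\<ge>x. L x > 0 \<and> L y \<le> exp 1 * (y / x) powr 1 * L x \<and> L x \<le> exp 1 * (y / x) powr 1 * L y"
    by blast
  then have x0: "L x > 0" "L y \<le> exp 1 * (y / x) powr 1 * L x" "L x \<le> exp 1 * (y / x) powr 1 * L y"
    if "x \<ge> x0" "y \<ge> x" for x y
    using that by blast+
  define C where "C = exp 1 * max 1 (\<delta> powr - (\<alpha> + 1))"
  have "\<forall>\<^sub>F t in sequentially. \<forall>m. \<delta> * real t \<le> real m \<longrightarrow> p m \<le> C * p t"
    using eventually_ge_at_top[of "nat \<lceil>x0\<rceil> + 1"] eventually_ge_at_top[of "nat \<lceil>x0 / \<delta>\<rceil> + 1"]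
  proof eventually_elim
    case (elim t)
    show ?case
    proof (intro allI impI)
      fix m assume m: "\<delta> * real t \<le> real m"
      have t: "x0 \<le> real t" "t \<ge> 1" using elim by linarith+
      have "x0 / \<delta> \<le> real t" using elim by linarith
      then have "x0 \<le> \<delta> * real t" using \<delta> by (simp add: field_simps)
      then have m': "x0 \<le> real m" using m by linarith
      then have m1: "real m > 0" "real t > 0" using potter(1) t by linarith+
      then have m2: "m \<ge> 1" by simp
      have pt: "p t \<ge> 0" using x0(1)[OF t(1) order_refl] t by (simp add: p less_imp_le)
      have m_powr: "real m powr - \<alpha> = (real m / real t) powr - \<alpha> * real t powr - \<alpha>"
        using m1 by (simp add: powr_divide)
      show "p m \<le> C * p t"
      proof (cases "t \<le> m")
        case True
        have "p m \<le> real m powr - \<alpha> * (exp 1 * (real m / real t) powr 1 * L (real t))"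
          using m2 t True unfolding p[OF m2] by (intro mult_left_mono x0) auto
        also have "\<dots> = exp 1 * ((real m / real t) powr (1 - \<alpha>)) * p t"
          proof -
          have "(real m / real t) powr (1 - \<alpha>) = (real m / real t) powr 1 * (real m / real t) powr - \<alpha>"
            unfolding powr_add[symmetric] by simp
          then show ?thesis by (simp only: p[OF t(2)] m_powr mult_ac)
        qed
        also have "(real m / real t) powr (1 - \<alpha>) \<le> 1 powr (1 - \<alpha>)"
          using True m1 \<alpha> by (intro powr_mono2') auto
        also have "exp 1 * 1 powr (1 - \<alpha>) * p t \<le> C * p t"
          using pt by (intro mult_right_mono) (auto simp: C_def)
        finally show ?thesis using pt by (simp add: mult_right_mono)
      next
        case False
        have "p m \<le> real m powr - \<alpha> * (exp 1 * (real t / real m) powr 1 * L (real t))"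
          using m' False unfolding p[OF m2] by (intro mult_left_mono x0) auto
        also have "\<dots> = exp 1 * ((real m / real t) powr - (\<alpha> + 1)) * p t"
          proof -
          have "(real t / real m) powr 1 = (real m / real t) powr - 1"
            using m1 by (simp add: powr_minus)
          moreover have "(real m / real t) powr - (\<alpha> + 1) = (real m / real t) powr - 1 * (real m / real t) powr - \<alpha>"
            unfolding powr_add[symmetric] by (simp add: algebra_simps)
          ultimately show ?thesis by (simp only: p[OF t(2)] m_powr mult_ac)
        qed
        also have "(real m / real t) powr - (\<alpha> + 1) \<le> \<delta> powr - (\<alpha> + 1)"
          using m m1 \<alpha> \<delta> by (intro powr_mono2') (auto simp: field_simps)
        also have "exp 1 * \<delta> powr - (\<alpha> + 1) * p t \<le> C * p t"
          using pt by (intro mult_right_mono) (auto simp: C_def)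
        finally show ?thesis using pt by (simp add: mult_right_mono)
      qed
    qed
  qed
  then show ?thesis by blast
qed

lemma regularly_varying_upper:
  assumes "e > 0"
  obtains C where "\<forall>\<^sub>F t in sequentially. p t \<le> C * real t powr (e - \<alpha>)"
proof -
  from slowly_varying_potter(1)[OF L assms] obtain x0
    where x0: "\<And>y. y \<ge> x0 \<Longrightarrow> L y \<le> exp e * (y / x0) powr e * L x0" "x0 > 0" by blast
  have "\<forall>\<^sub>F t in sequentially. p t \<le> (exp e * x0 powr - e * L x0) * real t powr (e - \<alpha>)"
    using eventually_ge_at_top[of "nat \<lceil>x0\<rceil> + 1"]
  proof eventually_elim
    case (elim t)
    then have t: "x0 \<le> real t" "t \<ge> 1" by linarith+
    have "p t \<le> real t powr - \<alpha> * (exp e * (real t / x0) powr e * L x0)"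
      unfolding p[OF t(2)] using t by (intro mult_left_mono x0) auto
    also have "\<dots> = (exp e * x0 powr - e * L x0) * real t powr (e - \<alpha>)"
      using t x0(2) by (simp add: powr_diff powr_divide powr_minus field_simps)
    finally show ?case .
  qed
  then show thesis by (rule that)
qed

text \<open>Potter's bound with exponent 1/2 from the fixed base point \<open>x0\<close> shows that
  \<open>L t\<close> is at least \<open>t powr - (1 / 2) / D\<close>; another half power of
  \<open>t\<close> absorbs \<open>D\<close>. This is the polynomial lower bound that the Chernoff
  error has to beat.\<close>

lemma regularly_varying_lower: "\<forall>\<^sub>F t in sequentially. real t powr - (\<alpha> + 1) \<le> p t"
proof -
  from slowly_varying_potter(1)[OF L, of "1 / 2"] obtain x0
    where x0: "\<And>y. y \<ge> x0 \<Longrightarrow> L x0 \<le> exp (1 / 2) * (y / x0) powr (1 / 2) * L y" "x0 > 0" "L x0 > 0" by auto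
  define D where "D = exp (1 / 2) * x0 powr - (1 / 2) / L x0"
  have D: "D > 0" using x0 by (simp add: D_def)
  have "filterlim (\<lambda>t::nat. real t powr (1 / 2)) at_top sequentially"
    by (rule filterlim_compose[OF real_powr_at_top filterlim_real_sequentially]) simp
  then have "\<forall>\<^sub>F t::nat in sequentially. D \<le> real t powr (1 / 2)" unfolding filterlim_at_top by blast
  then show ?thesis
    using eventually_ge_at_top[of "nat \<lceil>x0\<rceil> + 1"]
  proof eventually_elim
    case (elim t)
    then have t: "x0 \<le> real t" "t \<ge> 1" by linarith+
    have "1 \<le> D * real t powr (1 / 2) * L (real t)"
      using x0(1)[OF t(1)] x0(2,3) t by (simp add: D_def powr_divide powr_minus field_simps)
    also have "\<dots> \<le> real t powr (1 / 2) * real t powr (1 / 2) * L (real t)"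
    proof -
      have "0 < D * real t powr (1 / 2) * L (real t)" using calculation by linarith
      moreover have "0 < D * real t powr (1 / 2)" using D t by simp
      ultimately have "L (real t) > 0" by (rule zero_less_mult_pos)
      then show ?thesis using elim by (intro mult_right_mono) auto
    qed
    also have "real t powr (1 / 2) * real t powr (1 / 2) = real t powr 1"
      unfolding powr_add[symmetric] by simp
    finally have "real t powr - (\<alpha> + 1) * 1 \<le> real t powr - (\<alpha> + 1) * (real t powr 1 * L (real t))"
      by (intro mult_left_mono) auto
    also have "\<dots> = real t powr (- (\<alpha> + 1) + 1) * L (real t)" unfolding powr_add by simp
    also have "\<dots> = p t" using p[OF t(2)] by simp
    finally show ?case by simp
  qed
qed

lemma regularly_varying_summable:
  assumes r: "r < \<alpha> - 1" and nonneg: "\<And>t. p t \<ge> 0"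
  shows "summable (\<lambda>t. real t powr r * p t)"
proof -
  \<comment> \<open>Spending half of the gap between \<open>r\<close> and
    \<open>\<alpha> - 1\<close> keeps the final exponent \<open>r + (e - \<alpha>)\<close> below
    -1.\<close>
  define e where "e = (\<alpha> - 1 - r) / 2"
  have "e > 0" using r by (simp add: e_def)
  then obtain C where C: "\<forall>\<^sub>F t in sequentially. p t \<le> C * real t powr (e - \<alpha>)"
    by (rule regularly_varying_upper)
  show ?thesis
  proof (rule summable_comparison_test_ev)
    show "\<forall>\<^sub>F t in sequentially. norm (real t powr r * p t) \<le> C * real t powr (r + (e - \<alpha>))"
      using C
    proof eventually_elim
      case (elim t)
      have "real t powr r * p t \<le> real t powr r * (C * real t powr (e - \<alpha>))"
        using elim by (intro mult_left_mono) auto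
      then show ?case using nonneg by (simp add: powr_add mult_ac)
    qed
    show "summable (\<lambda>t. C * real t powr (r + (e - \<alpha>)))"
      using r by (intro summable_mult) (simp add: summable_real_powr_iff e_def field_simps)
  qed
qed

end

section \<open>Moments\<close>

lemma integrable_positive_part_powr:
  fixes P :: "int pmf"
  assumes "summable (\<lambda>m::nat. real m powr r * pmf P (int m))"
  shows "integrable P (\<lambda>x. max 0 (real_of_int x) powr r)"
proof (rule integrableI_bounded)
  have bij: "bij_betw int UNIV {0..}"
    by (auto simp: bij_betw_def intro!: inj_onI) (metis nat_0_le rangeI)
  \<comment> \<open>Since \<open>0 powr r = 0\<close>, negative integers contribute nothing and the
    integral becomes a series over the naturals.\<close>
  have "(\<integral>\<^sup>+x. ennreal (norm (max 0 (real_of_int x) powr r)) \<partial>P)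
      = (\<integral>\<^sup>+x. ennreal (pmf P x * max 0 (real_of_int x) powr r) * indicator {0..} x \<partial>count_space UNIV)"
    unfolding nn_integral_measure_pmf
    by (intro nn_integral_cong) (auto simp: indicator_def ennreal_mult'[symmetric])
  also have "\<dots> = (\<integral>\<^sup>+x. ennreal (pmf P x * max 0 (real_of_int x) powr r) \<partial>count_space {0..})"
    by (simp add: nn_integral_count_space_indicator)
  also have "\<dots> = (\<integral>\<^sup>+m. ennreal (real m powr r * pmf P (int m)) \<partial>count_space UNIV)"
    by (subst nn_integral_bij_count_space[OF bij, symmetric]) (simp add: mult.commute)
  also have "\<dots> = ennreal (\<Sum>m. real m powr r * pmf P (int m))"
    by (simp add: nn_integral_count_space_nat suminf_ennreal2 assms)
  finally show "(\<integral>\<^sup>+x. ennreal (norm (max 0 (real_of_int x) powr r)) \<partial>P) < \<infinity>" by simp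
qed simp

text \<open>Layer-cake formula for the integer part of \<open>\<bar>x\<bar> powr r\<close>. It
  exceeds \<open>t\<close> only if \<open>\<bar>x\<bar>\<close> reaches the \<open>r\<close>-th root
  of \<open>t + 1\<close>, so the tail decays with exponent \<open>r0 / r > 1\<close>. Rounding down
  loses at most 1.\<close>

lemma integrable_abs_powr_of_tail:
  fixes P :: "int pmf"
  assumes tail: "\<forall>\<^sub>F t::nat in sequentially. measure P {x. int t < \<bar>x\<bar>} \<le> C * real t powr - r0"
    and r: "0 < r" "r < r0"
  shows "integrable P (\<lambda>x. \<bar>real_of_int x\<bar> powr r)"
proof -
  let ?f = "\<lambda>x::int. nat \<lfloor>\<bar>real_of_int x\<bar> powr r\<rfloor>"
  \<comment> \<open>The largest integer strictly below the root: for integers, exceeding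
    \<open>?s t\<close> is the same as reaching the root.\<close>
  let ?s = "\<lambda>t::nat. nat \<lceil>real (Suc t) powr (1 / r)\<rceil> - 1"
  have sub: "{x. t < ?f x} \<subseteq> {x. int (?s t) < \<bar>x\<bar>}" for t
  proof safe
    fix x assume "t < ?f x"
    then have "real (Suc t) \<le> \<bar>real_of_int x\<bar> powr r" by linarith
    then have "real (Suc t) powr (1 / r) \<le> (\<bar>real_of_int x\<bar> powr r) powr (1 / r)"
      using r by (intro powr_mono2) auto
    also have "\<dots> = \<bar>real_of_int x\<bar>" using r by (simp add: powr_powr)
    finally have "\<lceil>real (Suc t) powr (1 / r)\<rceil> \<le> \<bar>x\<bar>" by linarith
    moreover have "real (Suc t) powr (1 / r) > 0" by simp
    then have "\<lceil>real (Suc t) powr (1 / r)\<rceil> > 0" by linarith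
    ultimately show "int (?s t) < \<bar>x\<bar>" by linarith
  qed
  have lim: "filterlim (\<lambda>t. real (Suc t) powr (1 / r)) at_top sequentially"
    using r filterlim_real_sequentially[THEN filterlim_sequentially_Suc[THEN iffD2]] by (intro filterlim_compose[OF real_powr_at_top]) auto
  have "summable (\<lambda>t. measure P {x. t < ?f x})"
  proof (rule summable_comparison_test_ev)
    show "summable (\<lambda>t. \<bar>C\<bar> * 2 powr r0 * real (Suc t) powr - (r0 / r))"
    proof (intro summable_mult)
      have "summable (\<lambda>t. real t powr - (r0 / r))"
        using r by (subst summable_real_powr_iff) (simp add: field_simps)
      then show "summable (\<lambda>t. real (Suc t) powr - (r0 / r))" by (subst summable_Suc_iff)
    qed
    have "filterlim ?s at_top sequentially"
      unfolding filterlim_at_top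
    proof
      fix Z :: nat
      show "\<forall>\<^sub>F t in sequentially. Z \<le> ?s t"
        using eventually_compose_filterlim[OF eventually_ge_at_top[of "real Z + 1"] lim]
        by eventually_elim linarith
    qed
    from eventually_compose_filterlim[OF tail this]
    show "\<forall>\<^sub>F t in sequentially. norm (measure P {x. t < ?f x}) \<le> \<bar>C\<bar> * 2 powr r0 * real (Suc t) powr - (r0 / r)"
      using eventually_compose_filterlim[OF eventually_ge_at_top[of 2] lim]
    proof eventually_elim
      case (elim t)
      define y where "y = real (Suc t) powr (1 / r)"
      \<comment> \<open>As \<open>y >= 2\<close>, the loss of at most 1 in \<open>?s t\<close> costs
        no more than a factor 2, hence the constant \<open>2 powr r0\<close>.\<close>
      have y: "y / 2 \<le> real (?s t)" "0 < y" using elim by (auto simp: y_def) linarith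
      have "measure P {x. t < ?f x} \<le> measure P {x. int (?s t) < \<bar>x\<bar>}"
        by (intro measure_pmf.finite_measure_mono sub) auto
      also have "\<dots> \<le> C * real (?s t) powr - r0" using elim by simp
      also have "\<dots> \<le> \<bar>C\<bar> * real (?s t) powr - r0" by (intro mult_right_mono) auto
      also have "\<dots> \<le> \<bar>C\<bar> * (y / 2) powr - r0"
        using y r by (intro mult_left_mono powr_mono2') auto
      also have "\<dots> = \<bar>C\<bar> * 2 powr r0 * real (Suc t) powr - (r0 / r)"
        using y by (simp add: powr_divide powr_minus y_def powr_powr divide_simps)
      finally show ?case by simp
    qed
  qed
  then have "(\<Sum>t. ennreal (measure P {x. t < ?f x})) < \<infinity>"
    by (subst suminf_ennreal2) auto
  then have fin: "(\<integral>\<^sup>+x. of_nat (?f x) \<partial>P) < \<infinity>"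
    by (subst nn_integral_nat_function) (auto simp: measure_pmf.emeasure_eq_measure)
  show ?thesis
  proof (rule integrableI_bounded)
    have "(\<integral>\<^sup>+x. ennreal (norm (\<bar>real_of_int x\<bar> powr r)) \<partial>P) \<le> (\<integral>\<^sup>+x. of_nat (?f x) + 1 \<partial>P)"
    proof (intro nn_integral_mono)
      fix x :: int
      have "z \<le> real (nat \<lfloor>z\<rfloor>) + 1" for z :: real by linarith
      then have "ennreal (\<bar>real_of_int x\<bar> powr r) \<le> ennreal (real (?f x) + 1)"
        by (rule ennreal_leI)
      then show "ennreal (norm (\<bar>real_of_int x\<bar> powr r)) \<le> of_nat (?f x) + 1"
        by (simp add: ennreal_plus ennreal_of_nat_eq_real_of_nat)
    qed
    also have "\<dots> = (\<integral>\<^sup>+x. of_nat (?f x) \<partial>P) + 1"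
      by (subst nn_integral_add) (auto simp: measure_pmf.emeasure_space_1[simplified])
    also have "\<dots> < \<infinity>" using fin by (simp add: less_top)
    finally show "(\<integral>\<^sup>+x. ennreal (norm (\<bar>real_of_int x\<bar> powr r)) \<partial>P) < \<infinity>" .
  qed simp
qed

text \<open>Markov's inequality for the moment of order \<open>r0\<close> of the positive part
  bounds the right tail, and \<open>left\<close> carries the bound over to the left tail. Returning
  from tails to moments needs the strict inequality \<open>r < r0\<close>.\<close>

lemma integrable_abs_powr:
  fixes P :: "int pmf"
  assumes sum: "summable (\<lambda>m::nat. real m powr r0 * pmf P (int m))"
    and left: "(\<lambda>t::nat. measure P {x. x < - int t}) \<in> O(\<lambda>t. measure P {x. x > int t})"
    and r: "0 < r" "r < r0"
  shows "integrable P (\<lambda>x. \<bar>real_of_int x\<bar> powr r)"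
proof -
  note int = integrable_positive_part_powr[OF sum]
  define K where "K = (\<integral>x. max 0 (real_of_int x) powr r0 \<partial>P)"
  have K: "measure P {x. x > int t} \<le> K * real t powr - r0" if "t > 0" for t :: nat
  proof -
    have "measure P {x. x > int t} \<le> measure P {x \<in> space P. real t powr r0 \<le> max 0 (real_of_int x) powr r0}"
      using r by (intro measure_pmf.finite_measure_mono) (auto intro!: powr_mono2)
    also have "\<dots> \<le> K / real t powr r0"
      unfolding K_def using that by (intro integral_Markov_inequality_measure[OF int]) auto
    finally show ?thesis by (simp add: powr_minus divide_inverse)
  qed
  from left obtain c where c: "\<forall>\<^sub>F t::nat in sequentially. measure P {x. x < - int t} \<le> c * measure P {x. x > int t}" "c > 0"
    by (auto elim!: landau_o.bigE)
  have "\<forall>\<^sub>F t::nat in sequentially. measure P {x. int t < \<bar>x\<bar>} \<le> ((c + 1) * K) * real t powr - r0"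
    using c(1) eventually_gt_at_top[of 0]
  proof eventually_elim
    case (elim t)
    have "measure P {x. int t < \<bar>x\<bar>} \<le> measure P ({x. x < - int t} \<union> {x. x > int t})"
      by (intro measure_pmf.finite_measure_mono) auto
    also have "\<dots> \<le> measure P {x. x < - int t} + measure P {x. x > int t}"
      by (intro measure_Un_le) auto
    also have "\<dots> \<le> (c + 1) * measure P {x. x > int t}" using elim by (simp add: algebra_simps)
    also have "\<dots> \<le> (c + 1) * (K * real t powr - r0)" using c elim by (intro mult_left_mono K) auto
    finally show ?case by simp
  qed
  then show ?thesis using r by (rule integrable_abs_powr_of_tail)
qed

section \<open>Random walks on the integers\<close>

definition conv_pmf :: "int pmf \<Rightarrow> int pmf \<Rightarrow> int pmf" where
  "conv_pmf P Q = bind_pmf P (\<lambda>x. map_pmf ((+) x) Q)"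

primrec walk_pmf :: "int pmf \<Rightarrow> nat \<Rightarrow> int pmf" where
  "walk_pmf P 0 = return_pmf 0"
| "walk_pmf P (Suc n) = conv_pmf P (walk_pmf P n)"

lemma pmf_shift: "pmf (map_pmf ((+) (x::int)) Q) t = pmf Q (t - x)"
  using pmf_map_inj'[of "(+) x" Q "t - x"] by simp

lemma pmf_conv_pmf: "pmf (conv_pmf P Q) t = (\<integral>x. pmf Q (t - x) \<partial>P)"
  by (simp add: conv_pmf_def pmf_bind pmf_shift)

lemma conv_pmf_commute: "conv_pmf P Q = conv_pmf Q P"
  unfolding conv_pmf_def map_pmf_def
  by (subst bind_commute_pmf) (simp add: add.commute)

lemma integrable_bounded_pmf:
  fixes f :: "'a \<Rightarrow> real"
  assumes "\<And>x. \<bar>f x\<bar> \<le> B"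
  shows "integrable (measure_pmf P) f"
  by (rule measure_pmf.integrable_const_bound[of _ B]) (use assms in auto)

lemma integral_conv_pmf:
  fixes f :: "int \<Rightarrow> real" and P Q :: "int pmf"
  assumes f: "\<And>x. 0 \<le> f x" "\<And>x. f x \<le> B"
  shows "(\<integral>z. f z \<partial>(conv_pmf P Q)) = (\<integral>x. (\<integral>s. f (x + s) \<partial>Q) \<partial>P)"
proof -
  have bd: "\<bar>f x\<bar> \<le> B" for x using f[of x] by simp
  have in_le: "(\<integral>s. f (x + s) \<partial>Q) \<le> B" for x
    by (rule measure_pmf.integral_le_const) (auto intro!: integrable_bounded_pmf bd f)
  have "ennreal (\<integral>z. f z \<partial>(conv_pmf P Q)) = (\<integral>\<^sup>+z. f z \<partial>(conv_pmf P Q))"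
    by (intro nn_integral_eq_integral[symmetric] integrable_bounded_pmf[OF bd]) (use f in auto)
  also have "\<dots> = (\<integral>\<^sup>+x. \<integral>\<^sup>+s. f (x + s) \<partial>Q \<partial>P)"
    by (simp add: conv_pmf_def)
  also have "\<dots> = (\<integral>\<^sup>+x. ennreal (\<integral>s. f (x + s) \<partial>Q) \<partial>P)"
    by (intro nn_integral_cong nn_integral_eq_integral integrable_bounded_pmf[OF bd]) (use f in auto)
  also have "\<dots> = ennreal (\<integral>x. (\<integral>s. f (x + s) \<partial>Q) \<partial>P)"
    by (intro nn_integral_eq_integral integrable_bounded_pmf[of _ B])
      (use f in_le in \<open>auto simp: abs_of_nonneg intro!: integral_nonneg\<close>)
  finally show ?thesis
    using f by (simp add: integral_nonneg)
qed

text \<open>Exchanges the roles of the two summands in the event that their sum is \<open>t\<close>.\<close>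
lemma integral_pmf_swap:
  fixes g :: "int \<Rightarrow> real" and P Q :: "int pmf"
  assumes "\<And>x. 0 \<le> g x" "\<And>x. g x \<le> B"
  shows "(\<integral>x. g x * pmf Q (t - x) \<partial>P) = (\<integral>s. g (t - s) * pmf P (t - s) \<partial>Q)"
proof -
  have bij: "bij (\<lambda>x. t - x)"
    by (rule bij_betw_byWitness[where f' = "\<lambda>x. t - x"]) auto
  have "(\<integral>\<^sup>+x. ennreal (g x * pmf Q (t - x)) \<partial>P)
      = (\<integral>\<^sup>+x. ennreal (pmf P x * g x * pmf Q (t - x)) \<partial>count_space UNIV)"
    using assms by (simp add: nn_integral_measure_pmf ennreal_mult' mult.assoc)
  also have "\<dots> = (\<integral>\<^sup>+x. ennreal (pmf P (t - x) * g (t - x) * pmf Q x) \<partial>count_space UNIV)"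
    using nn_integral_bij_count_space[OF bij, of "\<lambda>x. ennreal (pmf P x * g x * pmf Q (t - x))"] by simp
  also have "\<dots> = (\<integral>\<^sup>+s. ennreal (g (t - s) * pmf P (t - s)) \<partial>Q)"
    using assms by (simp add: nn_integral_measure_pmf ennreal_mult'[symmetric] mult_ac)
  finally show ?thesis
    using assms by (simp add: integral_eq_nn_integral)
qed

text \<open>Maximum principle. For \<open>t\<close> other than 0 the term at time 0 vanishes, and
  conditioning on the first step turns the rest into an average of shorter sums, each bounded by the
  sum at 0 by induction. Finite sums avoid any question of convergence.\<close>

lemma walk_pmf_le_origin:
  "(\<Sum>n<m. pmf (walk_pmf P n) t) \<le> (\<Sum>n<m. pmf (walk_pmf P n) 0)"
proof (induction m arbitrary: t)
  case (Suc m)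
  show ?case
  proof (cases "t = 0")
    case False
    have "(\<Sum>n<Suc m. pmf (walk_pmf P n) t) = (\<Sum>n<m. pmf (walk_pmf P (Suc n)) t)"
      using False by (subst sum.lessThan_Suc_shift) (simp add: pmf_return)
    also have "\<dots> = (\<integral>x. (\<Sum>n<m. pmf (walk_pmf P n) (t - x)) \<partial>P)"
      by (subst Bochner_Integration.integral_sum)
        (auto simp: pmf_conv_pmf pmf_le_1 intro!: integrable_bounded_pmf[of _ 1])
    also have "\<dots> \<le> (\<integral>x. (\<Sum>n<m. pmf (walk_pmf P n) 0) \<partial>P)"
    proof (intro integral_mono Bochner_Integration.integrable_sum)
      show "integrable P (\<lambda>x. pmf (walk_pmf P n) (t - x))" for n
        by (rule integrable_bounded_pmf[of _ 1]) (simp add: pmf_le_1)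
    qed (use Suc.IH in auto)
    also have "\<dots> \<le> (\<Sum>n<Suc m. pmf (walk_pmf P n) 0)" by simp
    finally show ?thesis .
  qed simp
qed simp

text \<open>For the walk started at \<open>A\<close>, \<open>V\<close> along the path is a
  supermartingale with values in \<open>[0, 1]\<close>. Its mean \<open>E n\<close> falls by at
  least \<open>d\<close> times the probability of being back at \<open>A\<close> at time
  \<open>n\<close>, and the total fall is at most 1.\<close>

lemma walk_pmf_origin_bound:
  fixes V :: "int \<Rightarrow> real" and P :: "int pmf"
  assumes V: "\<And>x. 0 \<le> V x" "\<And>x. V x \<le> 1"
    and super: "\<And>x. (\<integral>y. V (x + y) \<partial>P) \<le> V x"
    and strict: "d > 0" "(\<integral>y. V (A + y) \<partial>P) + d \<le> V A"
  shows "(\<Sum>n<m. pmf (walk_pmf P n) 0) \<le> 1 / d"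
proof -
  define E where "E n = (\<integral>s. V (A + s) \<partial>(walk_pmf P n))" for n
  have V1: "\<bar>V x\<bar> \<le> 1" for x using V[of x] by auto
  have step: "d * pmf (walk_pmf P n) 0 \<le> E n - E (Suc n)" for n
  proof -
    have PV1: "\<bar>\<integral>y. V (x + y) \<partial>P\<bar> \<le> 1" for x
      using order_trans[OF super V(2)] by (simp add: V integral_nonneg)
    \<comment> \<open>Commuting the convolution puts the walk outside and the fresh step inside, so
      that \<open>super\<close> applies at the point \<open>A + s\<close>.\<close>
    have "E (Suc n) = (\<integral>s. (\<integral>x. V (A + (s + x)) \<partial>P) \<partial>(walk_pmf P n))"
      unfolding E_def walk_pmf.simps
      by (subst conv_pmf_commute, subst integral_conv_pmf[where B = 1]) (use V in auto)
    then have "E n - E (Suc n) = (\<integral>s. V (A + s) - (\<integral>x. V ((A + s) + x) \<partial>P) \<partial>(walk_pmf P n))"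
      unfolding E_def
      by (subst Bochner_Integration.integral_diff)
        (auto simp: add.assoc V1 PV1[unfolded add.assoc] intro!: integrable_bounded_pmf[of _ 1] PV1[of "A + _", unfolded add.assoc])
    also have "\<dots> \<ge> (\<integral>s. d * indicator {0} s \<partial>(walk_pmf P n))"
    proof (rule integral_mono)
      show "integrable (walk_pmf P n) (\<lambda>s. V (A + s) - (\<integral>x. V ((A + s) + x) \<partial>P))"
        by (intro Bochner_Integration.integrable_diff integrable_bounded_pmf[of _ 1] V1 PV1)
      show "d * indicator {0} s \<le> V (A + s) - (\<integral>x. V ((A + s) + x) \<partial>P)" for s
        using super[of "A + s"] strict by (auto simp: indicator_def)
    next
      show "integrable (walk_pmf P n) (\<lambda>s. d * indicator {0} s)"
        by (rule integrable_bounded_pmf[of _ "\<bar>d\<bar>"]) (auto simp: indicator_def)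
    qed
    also have "(\<integral>s. d * indicator {0} s \<partial>(walk_pmf P n)) = d * pmf (walk_pmf P n) 0"
      by (simp add: measure_pmf_single)
    finally show ?thesis .
  qed
  have "d * (\<Sum>n<m. pmf (walk_pmf P n) 0) \<le> (\<Sum>n<m. E n - E (Suc n))"
    unfolding sum_distrib_left by (intro sum_mono step)
  also have "\<dots> = E 0 - E m" by (simp add: sum_lessThan_telescope')
  also have "\<dots> \<le> 1" proof -
    have "E m \<ge> 0" unfolding E_def by (intro Bochner_Integration.integral_nonneg V)
    then show ?thesis using V(2)[of A] by (simp add: E_def)
  qed
  finally show ?thesis using strict by (simp add: field_simps)
qed

text \<open>Induction on \<open>n\<close> by conditioning on the first step. If it exceeds
  \<open>y\<close>, exchanging the summands shows that it must take one prescribed value, at cost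
  \<open>K\<close>. Otherwise the induction hypothesis at \<open>t - x\<close> produces the factor
  \<open>exp (h * x)\<close>, whose truncated mean is at most \<open>F\<close>.\<close>

lemma walk_pmf_exponential_bound:
  fixes y t :: int and h K F :: real and P :: "int pmf"
  assumes K: "\<And>m. m > y \<Longrightarrow> pmf P m \<le> K" "K \<ge> 0"
    and F: "(\<integral>x. exp (h * real_of_int x) * indicator {..y} x \<partial>P) \<le> F" and h: "h \<ge> 0"
  shows "pmf (walk_pmf P n) t \<le> real n * K + exp (- h * real_of_int t) * F ^ n"
proof -
  have bd: "\<bar>exp (h * real_of_int x) * indicator {..y} x\<bar> \<le> exp (h * y)" for x
    using h by (auto simp: indicator_def intro: mult_left_mono)
  have F0: "F \<ge> 0" using F by (rule order_trans[rotated]) (auto intro!: integral_nonneg)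
  show ?thesis
  proof (induction n arbitrary: t)
    case 0
    then show ?case by (cases "t = 0") (auto simp: pmf_return)
  next
    case (Suc n)
    let ?q = "pmf (walk_pmf P n)"
    have q: "\<bar>?q x\<bar> \<le> 1" for x by (simp add: pmf_le_1)
    have "pmf (walk_pmf P (Suc n)) t = (\<integral>x. indicator {y<..} x * ?q (t - x) + indicator {..y} x * ?q (t - x) \<partial>P)"
      unfolding walk_pmf.simps pmf_conv_pmf by (intro Bochner_Integration.integral_cong) (auto simp: indicator_def)
    also have "\<dots> = (\<integral>x. indicator {y<..} x * ?q (t - x) \<partial>P) + (\<integral>x. indicator {..y} x * ?q (t - x) \<partial>P)"
      by (intro Bochner_Integration.integral_add integrable_bounded_pmf[of _ 1]) (auto simp: indicator_def pmf_le_1)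
    also have "(\<integral>x. indicator {y<..} x * ?q (t - x) \<partial>P) = (\<integral>s. indicator {y<..} (t - s) * pmf P (t - s) \<partial>(walk_pmf P n))"
      by (rule integral_pmf_swap[of _ 1]) auto
    also have "\<dots> \<le> (\<integral>s. K \<partial>(walk_pmf P n))"
      by (rule integral_mono[OF integrable_bounded_pmf[of _ 1]])
        (use K in \<open>auto simp: indicator_def pmf_le_1\<close>)
    also have "(\<integral>x. indicator {..y} x * ?q (t - x) \<partial>P)
        \<le> (\<integral>x. real n * K + exp (- h * real_of_int t) * F ^ n * (exp (h * real_of_int x) * indicator {..y} x) \<partial>P)"
    proof (rule integral_mono)
      show "integrable P (\<lambda>x. indicator {..y} x * ?q (t - x))"
        by (rule integrable_bounded_pmf[of _ 1]) (auto simp: indicator_def pmf_le_1)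
      show "integrable P (\<lambda>x. real n * K + exp (- h * real_of_int t) * F ^ n * (exp (h * real_of_int x) * indicator {..y} x))"
        by (intro Bochner_Integration.integrable_add integrable_mult_right integrable_bounded_pmf[OF bd]) auto
      fix x
      have "?q (t - x) \<le> real n * K + exp (- h * real_of_int (t - x)) * F ^ n" by (rule Suc.IH)
      also have "exp (- h * real_of_int (t - x)) = exp (- h * real_of_int t) * exp (h * real_of_int x)"
        by (simp add: exp_add[symmetric] algebra_simps)
      finally show "indicator {..y} x * ?q (t - x) \<le> real n * K + exp (- h * real_of_int t) * F ^ n * (exp (h * real_of_int x) * indicator {..y} x)"
        using K(2) by (auto simp: indicator_def mult_ac)
    qed
    also have "\<dots> = real n * K + exp (- h * real_of_int t) * F ^ n * (\<integral>x. exp (h * real_of_int x) * indicator {..y} x \<partial>P)"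
      by (subst Bochner_Integration.integral_add) (auto intro!: integrable_bounded_pmf[OF bd])
    also have "\<dots> \<le> real n * K + exp (- h * real_of_int t) * F ^ n * F"
      using F F0 by (intro add_left_mono mult_left_mono) auto
    finally show ?case by (simp add: algebra_simps)
  qed
qed

section \<open>Boundedness of the Green function\<close>

text \<open>Weighted arithmetic-geometric mean inequality for \<open>1 / (1 + s)\<close> and 1 with
  weights \<open>k\<close> and \<open>1 - k\<close>, followed by
  \<open>1 / (1 + s) = 1 - s + s\<^sup>2 / (1 + s)\<close>, where the denominator is at least
  1/2.\<close>

lemma powr_neg_taylor_bound:
  fixes s k :: real
  assumes "\<bar>s\<bar> \<le> 1 / 2" "0 < k" "k \<le> 1"
  shows "(1 + s) powr - k \<le> 1 - k * s + 2 * s\<^sup>2"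
proof -
  have s: "1 + s \<ge> 1 / 2" using assms by linarith
  have "(1 + s) powr - k = (1 / (1 + s)) powr k * 1 powr (1 - k)"
    using s by (simp add: powr_minus_divide powr_divide)
  also have "\<dots> \<le> k * (1 / (1 + s)) + (1 - k) * 1"
    using s assms by (intro Youngs_inequality_0) auto
  also have "\<dots> = 1 - k * s + k * (s\<^sup>2 / (1 + s))"
    using s by (simp add: field_simps power2_eq_square)
  also have "\<dots> \<le> 1 - k * s + 1 * (s\<^sup>2 / (1 / 2))"
    using s assms by (intro add_left_mono mult_mono divide_left_mono) auto
  finally show ?thesis by simp
qed

text \<open>For positive \<open>A\<close> and \<open>k\<close> this is the function
  \<open>min 1 ((A / x) powr k)\<close> on \<open>x > 0\<close>, extended by 1 to the other
  half-line.\<close>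

definition potential :: "real \<Rightarrow> real \<Rightarrow> real \<Rightarrow> real" where
  "potential A k x = (if x \<le> A then 1 else (A / x) powr k)"

lemma potential_bounds:
  assumes "A > 0" "k > 0"
  shows "0 \<le> potential A k x" "potential A k x \<le> 1"
  using assms by (auto simp: potential_def powr_le1)

text \<open>Three ranges of the relative jump \<open>s\<close>. Small jumps: second order Taylor
  bound, with \<open>s\<^sup>2\<close> at most \<open>\<bar>s\<bar> powr (1 + k)\<close>. Large
  upward jumps: the potential does not grow, and the error term pays for the linear term. Large
  downward jumps: the error term alone exceeds the maximum 1 of the potential.\<close>

lemma potential_increment:
  fixes A k x y :: real
  assumes A: "A > 0" and k: "0 < k" "k \<le> 1" and x: "x > A"
  defines "s \<equiv> y / x"
  shows "potential A k (x + y) \<le> (A / x) powr k * (1 - k * s) + 4 * \<bar>s\<bar> powr (1 + k)"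
proof -
  define B where "B = (A / x) powr k"
  have B: "0 < B" "B \<le> 1" using A x k by (auto simp: B_def powr_le1)
  have xy: "x + y = x * (1 + s)" using A x by (simp add: s_def field_simps)
  consider "\<bar>s\<bar> \<le> 1 / 2" | "s > 1 / 2" | "s < - (1 / 2)" by linarith
  then show ?thesis
  proof cases
    case 1
    then have s1: "1 + s > 0" by linarith
    have "potential A k (x + y) \<le> (A / (x + y)) powr k"
    proof (cases "x + y \<le> A")
      case True
      have "x * (1 + s) > 0" using x A s1 by simp
      then have "1 powr k \<le> (A / (x + y)) powr k" using k True xy A by (intro powr_mono2) (auto simp: field_simps)
      then show ?thesis using True by (simp add: potential_def)
    qed (simp add: potential_def)
    also have "\<dots> = B * (1 + s) powr - k"
      using x A s1 unfolding xy B_def by (simp add: powr_divide powr_mult powr_minus_divide)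
    also have "\<dots> \<le> B * (1 - k * s + 2 * s\<^sup>2)"
      using powr_neg_taylor_bound[OF 1 k] B by (intro mult_left_mono) auto
    also have "\<dots> = B * (1 - k * s) + B * (2 * s\<^sup>2)" by (simp add: algebra_simps)
    also have "B * (2 * s\<^sup>2) \<le> 1 * (4 * \<bar>s\<bar> powr (1 + k))"
    proof (rule mult_mono)
      have "s\<^sup>2 \<le> \<bar>s\<bar> powr (1 + k)"
      proof (cases "s = 0")
        case False
        have "s\<^sup>2 = \<bar>s\<bar> powr 2" using False by (simp add: powr_numeral)
        also have "\<dots> \<le> \<bar>s\<bar> powr (1 + k)" using False 1 k by (intro powr_mono') auto
        finally show ?thesis .
      qed simp
      then show "2 * s\<^sup>2 \<le> 4 * \<bar>s\<bar> powr (1 + k)" using zero_le_power2[of s] by linarith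
    qed (use B in auto)
    finally show ?thesis by (simp add: B_def)
  next
    case 2
    have y: "y \<ge> 0" using 2 x A by (simp add: s_def field_simps)
    have "potential A k (x + y) \<le> B"
      using x y A k unfolding potential_def B_def by (auto intro!: powr_mono2 divide_left_mono)
    also have "\<dots> = B * (1 - k * s) + B * (k * s)" by (simp add: algebra_simps)
    also have "B * (k * s) \<le> 1 * (4 * \<bar>s\<bar> powr (1 + k))"
    proof (rule mult_mono)
      have "(1 / 2) powr 1 \<le> (1 / 2 :: real) powr k" using k by (intro powr_mono') auto
      also have "\<dots> \<le> s powr k" using 2 k by (intro powr_mono2) auto
      finally have "s * (1 / 2) \<le> s * s powr k" using 2 by (intro mult_left_mono) auto
      also have "\<dots> = \<bar>s\<bar> powr (1 + k)" using 2 by (simp add: powr_add)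
      finally have "2 * s \<le> 4 * \<bar>s\<bar> powr (1 + k)" by simp
      moreover have "k * s \<le> 1 * s" using k 2 by (intro mult_right_mono) auto
      ultimately show "k * s \<le> 4 * \<bar>s\<bar> powr (1 + k)" using 2 by linarith
    qed (use B k 2 in auto)
    finally show ?thesis by (simp add: B_def)
  next
    case 3
    \<comment> \<open>The constant 4 comes from here: for \<open>\<bar>s\<bar> > 1 / 2\<close> and
      \<open>k <= 1\<close> the power \<open>\<bar>s\<bar> powr (1 + k)\<close> is at least
      1/4.\<close>
    have "(1 / 2) powr 2 \<le> (1 / 2 :: real) powr (1 + k)" using k by (intro powr_mono') auto
    also have "\<dots> \<le> \<bar>s\<bar> powr (1 + k)" using 3 k by (intro powr_mono2) auto
    finally have *: "1 \<le> 4 * \<bar>s\<bar> powr (1 + k)" by (simp add: power2_eq_square)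
    have "k * s \<le> 0" using k 3 by (intro mult_nonneg_nonpos) auto
    with B have "0 \<le> B * (1 - k * s)" by (intro mult_nonneg_nonneg) auto
    then show ?thesis using * potential_bounds(2)[OF A k(1), of "x + y"] by (simp add: B_def)
  qed
qed

text \<open>Integrating the increment bound at \<open>X > A\<close> compares the gain
  \<open>B * k / X * \<mu>\<close> from the drift with the loss
  \<open>4 * K / X powr (1 + k)\<close>. As \<open>B\<close> is \<open>(A / X) powr k\<close>, both
  have the same order in \<open>X\<close>, so one large \<open>A\<close> serves all
  \<open>X\<close>.\<close>

lemma walk_pmf_Green_bound:
  fixes P :: "int pmf"
  assumes k: "0 < k" "k \<le> 1"
    and int: "integrable P (\<lambda>x. \<bar>real_of_int x\<bar> powr (1 + k))" "integrable P real_of_int"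
    and mean: "(\<integral>x. real_of_int x \<partial>P) > 0"
  obtains U where "\<And>m t. (\<Sum>n<m. pmf (walk_pmf P n) t) \<le> U"
proof -
  define \<mu> where "\<mu> = (\<integral>x. real_of_int x \<partial>P)"
  define K where "K = (\<integral>x. \<bar>real_of_int x\<bar> powr (1 + k) \<partial>P)"
  have "filterlim (\<lambda>n::nat. real n powr k) at_top sequentially"
    by (rule filterlim_compose[OF real_powr_at_top filterlim_real_sequentially]) (fact k)
  \<comment> \<open>The condition on \<open>A\<close> that makes the drift gain dominate the error
    term.\<close>
  then have "\<forall>\<^sub>F n::nat in sequentially. 4 * K / (k * \<mu>) \<le> real n powr k"
    unfolding filterlim_at_top by blast
  from eventually_happens'[OF _ eventually_conj[OF this eventually_gt_at_top[of 0]]]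
  obtain A :: nat where A: "4 * K / (k * \<mu>) \<le> real A powr k" "A > 0" by auto
  define V where "V x = potential A k (real_of_int x)" for x
  have V: "0 \<le> V x" "V x \<le> 1" for x
    using potential_bounds[of A k] A k by (auto simp: V_def)
  have intV: "integrable P (\<lambda>y. V (x + y))" for x
    by (rule integrable_bounded_pmf[of _ 1]) (use V in auto)
  have super: "(\<integral>y. V (x + y) \<partial>P) \<le> V x" for x
  proof (cases "x \<le> int A")
    case True
    have "(\<integral>y. V (x + y) \<partial>P) \<le> 1"
      by (rule measure_pmf.integral_le_const[OF intV]) (use V in auto)
    then show ?thesis using True by (simp add: V_def potential_def)
  next
    case False
    define X where "X = real_of_int x"
    have X: "X > real A" "X > 0" using False by (auto simp: X_def)
    define B where "B = (A / X) powr k"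
    have "(\<integral>y. V (x + y) \<partial>P) \<le> (\<integral>y. B - B * k / X * real_of_int y + 4 / X powr (1 + k) * \<bar>real_of_int y\<bar> powr (1 + k) \<partial>P)"
    proof (rule integral_mono[OF intV])
      show "V (x + y) \<le> B - B * k / X * real_of_int y + 4 / X powr (1 + k) * \<bar>real_of_int y\<bar> powr (1 + k)" for y
      proof -
        have "V (x + y) \<le> B * (1 - k * (real_of_int y / X)) + 4 * \<bar>real_of_int y / X\<bar> powr (1 + k)"
          using potential_increment[of A k X "real_of_int y"] A k X by (simp add: V_def X_def B_def)
        also have "\<bar>real_of_int y / X\<bar> powr (1 + k) = \<bar>real_of_int y\<bar> powr (1 + k) / X powr (1 + k)"
          using X by (simp add: powr_divide)
        finally show ?thesis by (simp add: algebra_simps)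
      qed
    qed (use int in auto)
    also have "\<dots> = B - B * k / X * \<mu> + 4 / X powr (1 + k) * K"
      using int by (simp add: \<mu>_def K_def)
    also have "\<dots> \<le> B"
    proof -
      have "4 * K \<le> real A powr k * (k * \<mu>)" using A(1) k mean by (simp add: \<mu>_def field_simps)
      then have "4 / X powr (1 + k) * K \<le> real A powr k * (k * \<mu>) / X powr (1 + k)"
        using X by (simp add: field_simps)
      also have "\<dots> = B * k / X * \<mu>" using X A by (simp add: B_def powr_add powr_divide mult_ac)
      finally show ?thesis by simp
    qed
    also have "B = V x" using False X by (simp add: B_def V_def potential_def X_def)
    finally show ?thesis .
  qed
  \<comment> \<open>A positive mean requires an atom \<open>y0 > 0\<close>. A jump by
    \<open>y0\<close> from \<open>A\<close> leaves the plateau where \<open>V = 1\<close>, which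
    gives the strict decrease \<open>d\<close>.\<close>
  obtain y0 where y0: "y0 \<in> set_pmf P" "y0 > 0"
  proof (rule ccontr)
    assume "\<not> thesis"
    then have "AE y in P. 0 \<le> - real_of_int y" using that by (force simp: AE_measure_pmf_iff)
    then have "0 \<le> (\<integral>y. - real_of_int y \<partial>P)" by (rule integral_nonneg_AE)
    then show False using mean by simp
  qed
  define d where "d = (1 - V (int A + y0)) * pmf P y0"
  have "(real A / real_of_int (int A + y0)) powr k < 1 powr k"
    using A y0 k by (intro powr_less_mono2) auto
  then have "d > 0" using y0 by (simp add: d_def V_def potential_def pmf_positive)
  have intI: "integrable P (indicator {y0} :: int \<Rightarrow> real)"
    by (rule integrable_bounded_pmf[of _ 1]) (auto simp: indicator_def)
  have "(\<integral>y. V (int A + y) \<partial>P) \<le> (\<integral>y. 1 - (1 - V (int A + y0)) * indicator {y0} y \<partial>P)"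
    by (rule integral_mono[OF intV])
      (use V intI in \<open>auto split: split_indicator\<close>)
  also have "\<dots> = 1 - d"
    using intI by (simp add: d_def measure_pmf_single)
  finally have "(\<integral>y. V (int A + y) \<partial>P) + d \<le> V (int A)" by (simp add: V_def potential_def)
  from walk_pmf_origin_bound[OF V super \<open>d > 0\<close> this]
  have "(\<Sum>n<m. pmf (walk_pmf P n) t) \<le> 1 / d" for m t
    by (rule order_trans[OF walk_pmf_le_origin])
  then show thesis by (rule that)
qed

section \<open>Local probabilities of a big jump\<close>

text \<open>From \<open>exp z <= 1 + z * exp z\<close>: on \<open>(0, 1]\<close> the last
  exponential is at most \<open>exp 1\<close>, beyond 1 it is at most \<open>T\<close> and
  \<open>z <= z powr r\<close>. With \<open>z = h * x\<close> this bounds a truncated exponential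
  moment by moments of orders 1 and \<open>r\<close>.\<close>

lemma exp_le_linear_plus_powr:
  fixes z r T :: real
  assumes "1 \<le> r" "exp z \<le> T"
  shows "exp z \<le> 1 + exp 1 * \<bar>z\<bar> + \<bar>z\<bar> powr r * T"
proof -
  have T: "T > 0" using assms(2) exp_gt_zero[of z] by linarith
  have conv: "exp z \<le> 1 + z * exp z"
    using mult_left_mono[OF exp_ge_add_one_self[of "-z"], of "exp z"] by (simp add: algebra_simps exp_minus)
  have nonneg: "0 \<le> exp 1 * \<bar>z\<bar>" "0 \<le> \<bar>z\<bar> powr r * T" using T by auto
  consider "z \<le> 0" | "0 < z" "z \<le> 1" | "1 < z" by linarith
  then show ?thesis
  proof cases
    case 1
    then have "exp z \<le> 1" by simp
    then show ?thesis using nonneg by linarith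
  next
    case 2
    then have "z * exp z \<le> exp 1 * \<bar>z\<bar>" by (subst mult.commute, intro mult_mono) auto
    then show ?thesis using conv nonneg by linarith
  next
    case 3
    have "z powr 1 \<le> z powr r" using 3 assms by (intro powr_mono) auto
    then have "z * exp z \<le> \<bar>z\<bar> powr r * T" using 3 assms by (intro mult_mono) auto
    then show ?thesis using conv nonneg by linarith
  qed
qed

text \<open>Controls the contribution of the moment of order \<open>r\<close> to the Chernoff
  exponent when the number of steps is of order \<open>t\<close>.\<close>

lemma log_powr_negligible:
  fixes b r K :: real
  assumes "b > 0" "r > 1"
  shows "(\<lambda>t::nat. K * (real t * ((2 * b * ln (real t) / real t) powr r * real t powr ((r - 1) / 2)))) \<longlonglongrightarrow> 0"
proof -
  \<comment> \<open>With \<open>ln t <= t powr a / a\<close> and \<open>a * r = (r - 1) / 4\<close>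
    the powers of \<open>t\<close> add up to \<open>- (r - 1) / 4\<close>.\<close>
  define a where "a = (r - 1) / (4 * r)"
  have a: "a > 0" "a * r = (r - 1) / 4" using assms by (auto simp: a_def)
  have lim: "(\<lambda>t::nat. \<bar>K\<bar> * (2 * b / a) powr r * real t powr - ((r - 1) / 4)) \<longlonglongrightarrow> 0"
    using assms by (intro tendsto_mult_right_zero tendsto_neg_powr filterlim_real_sequentially) auto
  show ?thesis
  proof (rule Lim_null_comparison[OF _ lim])
    show "\<forall>\<^sub>F t::nat in sequentially. norm (K * (real t * ((2 * b * ln (real t) / real t) powr r * real t powr ((r - 1) / 2))))
        \<le> \<bar>K\<bar> * (2 * b / a) powr r * real t powr - ((r - 1) / 4)"
      using eventually_ge_at_top[of 2]
    proof eventually_elim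
      case (elim t)
      have "2 * b * ln (real t) / real t \<le> 2 * b * (real t powr a / a) / real t"
        using elim assms a by (intro divide_right_mono mult_left_mono ln_powr_bound) auto
      then have "(2 * b * ln (real t) / real t) powr r \<le> ((2 * b / a) * real t powr (a - 1)) powr r"
        using elim assms by (intro powr_mono2) (auto simp: powr_diff)
      also have "\<dots> = (2 * b / a) powr r * real t powr ((r - 1) / 4 - r)"
      proof -
        have "(a - 1) * r = (r - 1) / 4 - r" using a by (simp add: left_diff_distrib)
        then show ?thesis
          using assms a elim powr_mult[of "2 * b / a" "real t powr (a - 1)" r] by (simp only: powr_powr)
      qed
      finally have "real t * ((2 * b * ln (real t) / real t) powr r * real t powr ((r - 1) / 2))
          \<le> real t powr 1 * (((2 * b / a) powr r * real t powr ((r - 1) / 4 - r)) * real t powr ((r - 1) / 2))"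
        using elim by (intro mult_mono) auto
      also have "\<dots> = (2 * b / a) powr r * (real t powr (1 + ((r - 1) / 4 - r) + (r - 1) / 2))"
        using elim unfolding powr_add by simp
      also have "1 + ((r - 1) / 4 - r) + (r - 1) / 2 = - ((r - 1) / 4)" by (simp add: field_simps)
      finally have "\<bar>K\<bar> * (real t * ((2 * b * ln (real t) / real t) powr r * real t powr ((r - 1) / 2)))
          \<le> \<bar>K\<bar> * ((2 * b / a) powr r * real t powr - ((r - 1) / 4))"
        by (rule mult_left_mono) simp
      then show ?case by (simp add: abs_mult mult.assoc)
    qed
  qed
qed

text \<open>Balance of powers of \<open>t\<close>: \<open>exp (- h * t)\<close> is
  \<open>t powr - (2 * b)\<close>, while \<open>F ^ n\<close> is at most
  \<open>exp 1 * t powr b\<close> for \<open>n <= \<epsilon> * t\<close>. The truncated part is thus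
  at most \<open>exp 1 * t powr - b\<close>, which \<open>low\<close> compares with
  \<open>pmf P t\<close>. The mean need not be centred, because a small \<epsilon> absorbs
  it.\<close>

lemma walk_pmf_uniform_bound:
  fixes P :: "int pmf" and r b :: real
  assumes r: "1 < r" and int: "integrable P (\<lambda>x. \<bar>real_of_int x\<bar> powr r)" "integrable P real_of_int"
    and dom: "\<And>\<delta>. \<delta> > 0 \<Longrightarrow> \<exists>C. \<forall>\<^sub>F t::nat in sequentially. \<forall>m. \<delta> * real t \<le> real m \<longrightarrow> pmf P (int m) \<le> C * pmf P (int t)"
    and low: "b > 0" "\<forall>\<^sub>F t::nat in sequentially. real t powr - b \<le> pmf P (int t)"
  obtains \<epsilon> C where "\<epsilon> > 0"
    "\<forall>\<^sub>F t::nat in sequentially. \<forall>n. real n \<le> \<epsilon> * real t \<longrightarrow> pmf (walk_pmf P n) (int t) \<le> C * real n * pmf P (int t)"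
proof -
  define M where "M = (\<integral>x. \<bar>real_of_int x\<bar> \<partial>P)"
  define K where "K = (\<integral>x. \<bar>real_of_int x\<bar> powr r \<partial>P)"
  have MK: "M \<ge> 0" "K \<ge> 0" by (auto simp: M_def K_def)
  \<comment> \<open>Chosen so that \<open>exp (h * (\<delta> * t))\<close> equals \<open>T\<close>,
    that is \<open>t powr ((r - 1) / 2)\<close>.\<close>
  define \<delta> where "\<delta> = (r - 1) / (4 * b)"
  have \<delta>: "\<delta> > 0" using r low by (simp add: \<delta>_def)
  \<comment> \<open>Keeps the first-moment part \<open>n * exp 1 * h * M\<close> of the exponent
    below half of \<open>h * t\<close>, hence below \<open>b * ln t\<close>.\<close>
  define \<epsilon> where "\<epsilon> = 1 / (2 * exp 1 * (M + 1))"
  have "\<epsilon> * exp 1 * M = M / (2 * (M + 1))" by (simp add: \<epsilon>_def)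
  also have "\<dots> \<le> 1 / 2" using MK by (simp add: divide_simps)
  finally have \<epsilon>: "\<epsilon> > 0" "\<epsilon> * exp 1 * M \<le> 1 / 2" using MK by (simp_all add: \<epsilon>_def)
  from dom[OF \<delta>] obtain C where C: "\<forall>\<^sub>F t::nat in sequentially. \<forall>m. \<delta> * real t \<le> real m \<longrightarrow> pmf P (int m) \<le> C * pmf P (int t)"
    by blast
  have "\<forall>\<^sub>F t::nat in sequentially. \<epsilon> * K * (real t * ((2 * b * ln (real t) / real t) powr r * real t powr ((r - 1) / 2))) < 1"
    by (rule order_tendstoD(2)[OF log_powr_negligible]) (use r low in auto)
  then have "\<forall>\<^sub>F t::nat in sequentially. \<forall>n. real n \<le> \<epsilon> * real t \<longrightarrow> pmf (walk_pmf P n) (int t) \<le> (\<bar>C\<bar> + exp 1) * real n * pmf P (int t)"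
    using C low(2) eventually_ge_at_top[of 2]
  proof eventually_elim
    case (elim t)
    show ?case
    proof (intro allI impI)
      fix n assume n: "real n \<le> \<epsilon> * real t"
      define T where "T = real t powr ((r - 1) / 2)"
      define h where "h = 2 * b * ln (real t) / real t"
      define y where "y = \<lfloor>\<delta> * real t\<rfloor>"
      define F where "F = 1 + exp 1 * h * M + h powr r * T * K"
      have h: "h \<ge> 0" using elim low by (simp add: h_def)
      have Kbound: "pmf P m \<le> \<bar>C\<bar> * pmf P (int t)" if "m > y" for m
      proof -
        have m: "\<delta> * real t \<le> real_of_int m" using that unfolding y_def by linarith
        then have "0 \<le> real_of_int m" using \<delta> by (meson mult_nonneg_nonneg less_imp_le of_nat_0_le_iff order_trans)
        then have "m = int (nat m)" by simp
        then have "pmf P m \<le> C * pmf P (int t)" using elim(2) m by (metis of_int_of_nat_eq)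
        also have "\<dots> \<le> \<bar>C\<bar> * pmf P (int t)" by (intro mult_right_mono) auto
        finally show ?thesis .
      qed
      have "(\<integral>x. exp (h * real_of_int x) * indicator {..y} x \<partial>P)
          \<le> (\<integral>x. 1 + exp 1 * h * \<bar>real_of_int x\<bar> + h powr r * T * \<bar>real_of_int x\<bar> powr r \<partial>P)"
      proof (rule integral_mono)
        show "integrable P (\<lambda>x. exp (h * real_of_int x) * indicator {..y} x)"
          by (rule integrable_bounded_pmf[of _ "exp (h * y)"]) (use h in \<open>auto simp: indicator_def intro: mult_left_mono\<close>)
        show "exp (h * real_of_int x) * indicator {..y} x
            \<le> 1 + exp 1 * h * \<bar>real_of_int x\<bar> + h powr r * T * \<bar>real_of_int x\<bar> powr r" for x
        proof (cases "x \<le> y")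
          case True
          have "h * real_of_int x \<le> h * (\<delta> * real t)"
            using True h unfolding y_def by (intro mult_left_mono) linarith+
          also have "\<dots> = (r - 1) / 2 * ln (real t)" using elim low by (simp add: h_def \<delta>_def field_simps)
          finally have "exp (h * real_of_int x) \<le> T" using elim by (simp add: T_def powr_def)
          from exp_le_linear_plus_powr[OF _ this, of r] show ?thesis
            using True r h by (simp add: abs_mult powr_mult mult_ac)
        next
          case False
          have "0 \<le> 1 + exp 1 * h * \<bar>real_of_int x\<bar> + h powr r * T * \<bar>real_of_int x\<bar> powr r"
            using h by (intro add_nonneg_nonneg mult_nonneg_nonneg) (auto simp: T_def)
          with False show ?thesis by simp
        qed
      qed (use int in auto)
      also have "\<dots> = F" using int by (simp add: F_def M_def K_def)
      finally have F: "(\<integral>x. exp (h * real_of_int x) * indicator {..y} x \<partial>P) \<le> F" .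
      have pm: "pmf (walk_pmf P n) (int t) \<le> real n * (\<bar>C\<bar> * pmf P (int t)) + exp (- h * real_of_int (int t)) * F ^ n"
        by (rule walk_pmf_exponential_bound[OF Kbound _ F h]) auto
      show "pmf (walk_pmf P n) (int t) \<le> (\<bar>C\<bar> + exp 1) * real n * pmf P (int t)"
      \<comment> \<open>The claimed bound is 0 for \<open>n = 0\<close>, where the walk has not left
        0; for \<open>n >= 1\<close> the Chernoff error fits under
        \<open>n * pmf P t\<close>.\<close>
      proof (cases "n = 0")
        case True
        then show ?thesis using elim by (simp add: pmf_return)
      next
        case False
        have Fm1: "exp 1 * h * M + h powr r * T * K \<ge> 0"
          using h MK by (intro add_nonneg_nonneg mult_nonneg_nonneg) (auto simp: T_def)
        have "F ^ n \<le> exp (exp 1 * h * M + h powr r * T * K) ^ n"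
          unfolding F_def using Fm1 by (intro power_mono) (simp_all add: add.assoc)
        also have "\<dots> = exp (real n * (exp 1 * h * M + h powr r * T * K))"
          by (simp add: exp_of_nat_mult)
        also have "\<dots> \<le> exp (b * ln (real t) + 1)"
        proof -
          have "real n * (exp 1 * h * M + h powr r * T * K) \<le> \<epsilon> * real t * (exp 1 * h * M + h powr r * T * K)"
            using n Fm1 by (intro mult_right_mono)
          also have "\<dots> = \<epsilon> * exp 1 * M * (real t * h) + \<epsilon> * K * (real t * (h powr r * T))"
            by (simp add: algebra_simps)
          also have "\<dots> \<le> 1 / 2 * (real t * h) + 1"
            using \<epsilon> h elim(1) unfolding h_def[symmetric] T_def[symmetric]
            by (intro add_mono mult_right_mono) auto
          also have "real t * h = 2 * b * ln (real t)" using elim by (simp add: h_def)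
          finally show ?thesis by simp
        qed
        finally have "exp (- h * real_of_int (int t)) * F ^ n \<le> exp (- h * real t) * exp (b * ln (real t) + 1)"
          by simp
        also have "\<dots> = exp 1 * real t powr - b"
          using elim by (simp add: h_def powr_def exp_add[symmetric] algebra_simps)
        also have "\<dots> \<le> exp 1 * (real n * pmf P (int t))"
        proof -
          have "real t powr - b \<le> 1 * pmf P (int t)" using elim by simp
          also have "\<dots> \<le> real n * pmf P (int t)" using False by (intro mult_right_mono) auto
          finally show ?thesis by simp
        qed
        finally show ?thesis using pm by (simp add: algebra_simps)
      qed
    qed
  qed
  with \<epsilon>(1) show thesis by (rule that)
qed

section \<open>One big jump in convolutions\<close>

text \<open>With \<open>x <= t / 2\<close> for the summand from \<open>P\<close>, the other one is
  \<open>t - x >= t / 2\<close> and carries the big jump. For fixed \<open>x\<close> the quotient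
  tends to \<open>B\<close> by \<open>long\<close>; \<open>dom\<close> gives a constant majorant.
  The family \<open>S\<close> is left open so that both halves of a convolution fit.\<close>

lemma tendsto_half_convolution:
  fixes P Q :: "int pmf" and g :: "nat \<Rightarrow> real"
  assumes pos: "\<forall>\<^sub>F t in sequentially. 0 < g t"
    and long: "\<And>k::int. (\<lambda>t. g (nat (int t - k)) / g t) \<longlonglongrightarrow> 1"
    and dom: "\<forall>\<^sub>F t in sequentially. \<forall>m. t \<le> 2 * m \<longrightarrow> g m \<le> C * g t"
    and Q: "(\<lambda>t. pmf Q (int t) / g t) \<longlonglongrightarrow> B"
    and S: "\<And>t x. x \<in> S t \<Longrightarrow> 2 * x \<le> int t" "\<And>x. \<forall>\<^sub>F t in sequentially. x \<in> S t"
  shows "(\<lambda>t. (\<integral>x. indicator (S t) x * pmf Q (int t - x) \<partial>P) / g t) \<longlonglongrightarrow> B"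
proof -
  have natlim: "filterlim (\<lambda>t. nat (int t - k)) at_top sequentially" for k
    unfolding filterlim_at_top
  proof
    fix z :: nat
    show "\<forall>\<^sub>F t in sequentially. z \<le> nat (int t - k)"
      using eventually_ge_at_top[of "z + nat \<bar>k\<bar>"] by eventually_elim linarith
  qed
  have "\<forall>\<^sub>F t in sequentially. pmf Q (int t) / g t < B + 1"
    using Q by (rule order_tendstoD) simp
  then have "\<forall>\<^sub>F t in sequentially. pmf Q (int t) \<le> (\<bar>B\<bar> + 1) * g t"
    using pos
  proof eventually_elim
    case (elim t)
    then have "pmf Q (int t) \<le> (B + 1) * g t" by (simp add: field_simps)
    also have "\<dots> \<le> (\<bar>B\<bar> + 1) * g t" using elim by (intro mult_right_mono) auto
    finally show ?case .
  qed
  then obtain T0 where T0: "\<And>m. m \<ge> T0 \<Longrightarrow> pmf Q (int m) \<le> (\<bar>B\<bar> + 1) * g m"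
    unfolding eventually_sequentially by blast
  from eventually_conj[OF pos dom] obtain T1
    where T1: "\<And>t. t \<ge> T1 \<Longrightarrow> 0 < g t" "\<And>t m. t \<ge> T1 \<Longrightarrow> t \<le> 2 * m \<Longrightarrow> g m \<le> C * g t"
    unfolding eventually_sequentially by blast
  \<comment> \<open>From \<open>t >= 2 * T0\<close> follows \<open>t - x >= T0\<close>. Shifting the
    sequence by \<open>T\<close> makes the majorant valid at every index, as dominated convergence
    requires.\<close>
  define T where "T = max (2 * T0) T1"
  have bound: "\<bar>indicator (S t) x * pmf Q (int t - x) / g t\<bar> \<le> (\<bar>B\<bar> + 1) * \<bar>C\<bar>" if t: "t \<ge> T" for t x
  proof (cases "x \<in> S t")
    case True
    define m where "m = nat (int t - x)"
    have m: "int m = int t - x" "t \<le> 2 * m" "T0 \<le> m" using S(1)[OF True] t by (auto simp: m_def T_def)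
    have "pmf Q (int m) \<le> (\<bar>B\<bar> + 1) * g m" using T0 m by blast
    also have "\<dots> \<le> (\<bar>B\<bar> + 1) * (\<bar>C\<bar> * g t)"
    proof (intro mult_left_mono)
      have "g m \<le> C * g t" using T1(2) m t by (simp add: T_def)
      also have "\<dots> \<le> \<bar>C\<bar> * g t" using T1(1)[of t] t by (intro mult_right_mono) (auto simp: T_def)
      finally show "g m \<le> \<bar>C\<bar> * g t" .
    qed simp
    finally show ?thesis using T1(1)[of t] t True m by (simp add: T_def field_simps)
  qed simp
  have "(\<lambda>t. \<integral>x. indicator (S (t + T)) x * pmf Q (int (t + T) - x) / g (t + T) \<partial>P) \<longlonglongrightarrow> (\<integral>x. B \<partial>P)"
  proof (rule integral_dominated_convergence[where w = "\<lambda>_. (\<bar>B\<bar> + 1) * \<bar>C\<bar>"])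
    show "AE x in P. (\<lambda>t. indicator (S (t + T)) x * pmf Q (int (t + T) - x) / g (t + T)) \<longlonglongrightarrow> B"
    proof (rule AE_I2, rule LIMSEQ_ignore_initial_segment)
      fix x
      have "(\<lambda>t. pmf Q (int (nat (int t - x))) / g (nat (int t - x)) * (g (nat (int t - x)) / g t)) \<longlonglongrightarrow> B * 1"
        by (intro tendsto_mult long filterlim_compose[OF Q natlim])
      moreover have "\<forall>\<^sub>F t in sequentially. pmf Q (int (nat (int t - x))) / g (nat (int t - x)) * (g (nat (int t - x)) / g t)
            = indicator (S t) x * pmf Q (int t - x) / g t"
        using S(2)[of x] eventually_compose_filterlim[OF pos natlim[of x]] eventually_ge_at_top[of "nat \<bar>x\<bar>"]
        by eventually_elim auto
      ultimately have "(\<lambda>t. indicator (S t) x * pmf Q (int t - x) / g t) \<longlonglongrightarrow> B * 1"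
        by (rule Lim_transform_eventually)
      then show "(\<lambda>t. indicator (S t) x * pmf Q (int t - x) / g t) \<longlonglongrightarrow> B" by simp
    qed
    show "AE x in P. norm (indicator (S (t + T)) x * pmf Q (int (t + T) - x) / g (t + T)) \<le> (\<bar>B\<bar> + 1) * \<bar>C\<bar>" for t
      using bound[of "t + T"] by simp
  qed auto
  then have "(\<lambda>t. (\<integral>x. indicator (S (t + T)) x * pmf Q (int (t + T) - x) \<partial>P) / g (t + T)) \<longlonglongrightarrow> B"
    by simp
  then show ?thesis by (rule LIMSEQ_offset)
qed

text \<open>Splitting at half of \<open>t\<close> and exchanging the summands in the part where the
  one from \<open>P\<close> is large leaves two half convolutions, with limits \<open>A\<close> and
  \<open>B\<close>. One cut is strict, so \<open>2 * x = t\<close> is counted once. A common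
  \<open>g\<close> allows zero limits.\<close>

lemma tendsto_pmf_conv_pmf:
  fixes P Q :: "int pmf" and g :: "nat \<Rightarrow> real"
  assumes pos: "\<forall>\<^sub>F t in sequentially. 0 < g t"
    and long: "\<And>k::int. (\<lambda>t. g (nat (int t - k)) / g t) \<longlonglongrightarrow> 1"
    and dom: "\<forall>\<^sub>F t in sequentially. \<forall>m. t \<le> 2 * m \<longrightarrow> g m \<le> C * g t"
    and P: "(\<lambda>t. pmf P (int t) / g t) \<longlonglongrightarrow> A"
    and Q: "(\<lambda>t. pmf Q (int t) / g t) \<longlonglongrightarrow> B"
  shows "(\<lambda>t. pmf (conv_pmf P Q) (int t) / g t) \<longlonglongrightarrow> A + B"
proof -
  have split: "pmf (conv_pmf P Q) (int t) = (\<integral>s. indicator {s. 2 * s < int t} s * pmf P (int t - s) \<partial>Q)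
      + (\<integral>x. indicator {x. 2 * x \<le> int t} x * pmf Q (int t - x) \<partial>P)" for t
  proof -
    have "pmf (conv_pmf P Q) (int t) = (\<integral>x. indicator {x. int t < 2 * x} x * pmf Q (int t - x)
        + indicator {x. 2 * x \<le> int t} x * pmf Q (int t - x) \<partial>P)"
      unfolding pmf_conv_pmf by (intro Bochner_Integration.integral_cong) (auto simp: indicator_def)
    also have "\<dots> = (\<integral>x. indicator {x. int t < 2 * x} x * pmf Q (int t - x) \<partial>P)
        + (\<integral>x. indicator {x. 2 * x \<le> int t} x * pmf Q (int t - x) \<partial>P)"
      by (intro Bochner_Integration.integral_add integrable_bounded_pmf[of _ 1]) (auto simp: indicator_def pmf_le_1)
    also have "(\<integral>x. indicator {x. int t < 2 * x} x * pmf Q (int t - x) \<partial>P)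
        = (\<integral>s. indicator {x. int t < 2 * x} (int t - s) * pmf P (int t - s) \<partial>Q)"
      by (rule integral_pmf_swap[of _ 1]) auto
    also have "\<dots> = (\<integral>s. indicator {s. 2 * s < int t} s * pmf P (int t - s) \<partial>Q)"
      by (intro Bochner_Integration.integral_cong) (auto simp: indicator_def)
    finally show ?thesis .
  qed
  have ev: "\<forall>\<^sub>F t in sequentially. 2 * x < int t" for x
    using eventually_gt_at_top[of "nat (2 * \<bar>x\<bar>)"] by eventually_elim linarith
  have ev': "\<forall>\<^sub>F t in sequentially. 2 * x \<le> int t" for x
    by (rule eventually_mono[OF ev[of x]]) simp
  show ?thesis
    unfolding split add_divide_distrib
    by (intro tendsto_add tendsto_half_convolution[OF pos long dom P] tendsto_half_convolution[OF pos long dom Q])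
      (auto intro: ev ev')
qed

text \<open>Each further step adds 1 to the limit. The start is 0, since the unit mass at 0 is
  invisible at positive \<open>t\<close>.\<close>

lemma tendsto_pmf_walk_pmf:
  fixes P :: "int pmf"
  assumes pos: "\<forall>\<^sub>F t in sequentially. 0 < pmf P (int t)"
    and long: "\<And>k::int. (\<lambda>t. pmf P (int (nat (int t - k))) / pmf P (int t)) \<longlonglongrightarrow> 1"
    and dom: "\<forall>\<^sub>F t::nat in sequentially. \<forall>m. t \<le> 2 * m \<longrightarrow> pmf P (int m) \<le> C * pmf P (int t)"
  shows "(\<lambda>t. pmf (walk_pmf P n) (int t) / pmf P (int t)) \<longlonglongrightarrow> real n"
proof (induction n)
  case 0
  have "\<forall>\<^sub>F t in sequentially. pmf (walk_pmf P 0) (int t) / pmf P (int t) = 0"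
    using eventually_gt_at_top[of 0] by eventually_elim (simp add: pmf_return)
  then show ?case by (simp add: tendsto_eventually)
next
  case (Suc n)
  have "(\<lambda>t. pmf P (int t) / pmf P (int t)) \<longlonglongrightarrow> 1"
    using pos by (intro tendsto_eventually) (auto elim: eventually_mono)
  from tendsto_pmf_conv_pmf[where g = "\<lambda>t. pmf P (int t)", OF pos long dom this Suc]
  show ?case by (simp add: add.commute)
qed

section \<open>Random sums\<close>

lemma integrable_nat_pmf:
  fixes R :: "nat pmf"
  assumes "summable (\<lambda>n. real n * pmf R n)"
  shows "integrable R real"
proof (rule integrableI_bounded)
  have "(\<integral>\<^sup>+n. ennreal (norm (real n)) \<partial>R) = (\<Sum>n. ennreal (real n * pmf R n))"
    by (simp add: nn_integral_measure_pmf nn_integral_count_space_nat ennreal_mult'[symmetric] mult.commute)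
  also have "\<dots> = ennreal (\<Sum>n. real n * pmf R n)"
    by (intro suminf_ennreal2 assms) auto
  finally show "(\<integral>\<^sup>+n. ennreal (norm (real n)) \<partial>R) < \<infinity>" by simp
qed simp

text \<open>On \<open>S\<close> the weights of \<open>R\<close> are replaced by their common bound
  \<kappa>, after which the whole series of \<open>q\<close> is available; \<open>q\<close> will be
  the Green function at a fixed point.\<close>

lemma integral_nat_pmf_large_index_le:
  fixes R :: "nat pmf" and q :: "nat \<Rightarrow> real"
  assumes q: "\<And>n. 0 \<le> q n" "\<And>m. (\<Sum>n<m. q n) \<le> U" and R: "\<And>n. n \<in> S \<Longrightarrow> pmf R n \<le> \<kappa>" and "0 \<le> \<kappa>"
  shows "(\<integral>n. indicator S n * q n \<partial>R) \<le> \<kappa> * U"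
proof -
  have U: "0 \<le> U" using q(2)[of 0] by simp
  have "(\<integral>\<^sup>+n. ennreal (indicator S n * q n) \<partial>R) \<le> (\<integral>\<^sup>+n. ennreal \<kappa> * ennreal (q n) \<partial>count_space UNIV)"
    unfolding nn_integral_measure_pmf
    by (intro nn_integral_mono) (use q R in \<open>auto simp: indicator_def intro!: mult_mono ennreal_leI\<close>)
  also have "\<dots> = ennreal \<kappa> * (\<Sum>n. ennreal (q n))"
    by (simp add: nn_integral_cmult nn_integral_count_space_nat)
  also have "\<dots> \<le> ennreal \<kappa> * ennreal U"
  proof (intro mult_left_mono suminf_le_const)
    show "(\<Sum>n<m. ennreal (q n)) \<le> ennreal U" for m
      using q by (simp add: sum_ennreal ennreal_leI)
  qed auto
  finally have "(\<integral>\<^sup>+n. ennreal (indicator S n * q n) \<partial>R) \<le> ennreal (\<kappa> * U)"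
    using assms U by (simp add: ennreal_mult)
  then have "enn2real (\<integral>\<^sup>+n. ennreal (indicator S n * q n) \<partial>R) \<le> \<kappa> * U"
    by (rule enn2real_leI[rotated]) (use assms U in auto)
  then show ?thesis
    using q by (subst integral_eq_nn_integral) auto
qed

text \<open>Below the cut, \<open>n * \<bar>C\<bar>\<close> is an integrable majorant under
  \<open>R\<close>; above it, \<open>dom\<close> with \<delta> = \<epsilon> makes the smallness of
  \<open>pmf R n\<close> uniform, and \<open>green\<close> sums the walk probabilities.\<close>

lemma tendsto_random_index:
  fixes P :: "int pmf" and R :: "nat pmf"
  assumes pos: "\<forall>\<^sub>F t in sequentially. 0 < pmf P (int t)"
    and long: "\<And>k::int. (\<lambda>t. pmf P (int (nat (int t - k))) / pmf P (int t)) \<longlonglongrightarrow> 1"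
    and dom: "\<And>\<delta>. \<delta> > 0 \<Longrightarrow> \<exists>C. \<forall>\<^sub>F t::nat in sequentially. \<forall>m. \<delta> * real t \<le> real m \<longrightarrow> pmf P (int m) \<le> C * pmf P (int t)"
    and green: "\<And>m t. (\<Sum>n<m. pmf (walk_pmf P n) t) \<le> U"
    and \<epsilon>: "\<epsilon> > 0"
    and unif: "\<forall>\<^sub>F t::nat in sequentially. \<forall>n. real n \<le> \<epsilon> * real t \<longrightarrow> pmf (walk_pmf P n) (int t) \<le> C * real n * pmf P (int t)"
    and R: "(\<lambda>t. pmf R t) \<in> o(\<lambda>t. pmf P (int t))" "integrable R real"
  shows "(\<lambda>t. (\<integral>n. pmf (walk_pmf P n) (int t) \<partial>R) / pmf P (int t)) \<longlonglongrightarrow> (\<integral>n. real n \<partial>R)"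
proof -
  define S where "S t = {n. real n \<le> \<epsilon> * real t}" for t :: nat
  let ?q = "\<lambda>t n. pmf (walk_pmf P n) (int t)"
  have U: "0 \<le> U" using green[of _ 0] by simp
  have dom2: "\<exists>C. \<forall>\<^sub>F t::nat in sequentially. \<forall>m. t \<le> 2 * m \<longrightarrow> pmf P (int m) \<le> C * pmf P (int t)"
  proof -
    have "1 / 2 * real t \<le> real m \<longleftrightarrow> t \<le> 2 * m" for t m :: nat by linarith
    then show ?thesis using dom[of "1 / 2"] by simp
  qed
  then have walk: "(\<lambda>t. ?q t n / pmf P (int t)) \<longlonglongrightarrow> real n" for n
    using tendsto_pmf_walk_pmf[OF pos long] by blast
  have bulk: "(\<lambda>t. (\<integral>n. indicator (S t) n * ?q t n \<partial>R) / pmf P (int t)) \<longlonglongrightarrow> (\<integral>n. real n \<partial>R)"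
  proof -
    from eventually_conj[OF pos unif] obtain T where T: "\<And>t. t \<ge> T \<Longrightarrow> 0 < pmf P (int t)"
      "\<And>t n. t \<ge> T \<Longrightarrow> n \<in> S t \<Longrightarrow> ?q t n \<le> C * real n * pmf P (int t)"
      unfolding eventually_sequentially S_def by blast
    have "(\<lambda>t. \<integral>n. indicator (S (t + T)) n * ?q (t + T) n / pmf P (int (t + T)) \<partial>R) \<longlonglongrightarrow> (\<integral>n. real n \<partial>R)"
    proof (rule integral_dominated_convergence[where w = "\<lambda>n. \<bar>C\<bar> * real n"])
      show "AE n in R. (\<lambda>t. indicator (S (t + T)) n * ?q (t + T) n / pmf P (int (t + T))) \<longlonglongrightarrow> real n"
      proof (rule AE_I2, rule LIMSEQ_ignore_initial_segment)
        fix n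
        have "\<forall>\<^sub>F t in sequentially. ?q t n / pmf P (int t) = indicator (S t) n * ?q t n / pmf P (int t)"
          using eventually_ge_at_top[of "nat \<lceil>real n / \<epsilon>\<rceil>"]
        proof eventually_elim
          case (elim t)
          then have "real n / \<epsilon> \<le> real t" by linarith
          then have "n \<in> S t" using \<epsilon> by (simp add: S_def field_simps)
          then show ?case by simp
        qed
        with walk show "(\<lambda>t. indicator (S t) n * ?q t n / pmf P (int t)) \<longlonglongrightarrow> real n"
          by (rule Lim_transform_eventually)
      qed
      show "AE n in R. norm (indicator (S (t + T)) n * ?q (t + T) n / pmf P (int (t + T))) \<le> \<bar>C\<bar> * real n" for t
      proof (rule AE_I2)
        fix n
        show "norm (indicator (S (t + T)) n * ?q (t + T) n / pmf P (int (t + T))) \<le> \<bar>C\<bar> * real n"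
        proof (cases "n \<in> S (t + T)")
          case True
          have "?q (t + T) n \<le> C * real n * pmf P (int (t + T))" using True by (intro T) auto
          also have "\<dots> \<le> \<bar>C\<bar> * real n * pmf P (int (t + T))" by (intro mult_right_mono) auto
          finally show ?thesis using True T(1)[of "t + T"] by (simp add: field_simps)
        qed simp
      qed
    qed (use R in auto)
    then have "(\<lambda>t. (\<integral>n. indicator (S (t + T)) n * ?q (t + T) n \<partial>R) / pmf P (int (t + T))) \<longlonglongrightarrow> (\<integral>n. real n \<partial>R)"
      by simp
    then show ?thesis by (rule LIMSEQ_offset)
  qed
  have large: "(\<lambda>t. (\<integral>n. indicator (- S t) n * ?q t n \<partial>R) / pmf P (int t)) \<longlonglongrightarrow> 0"
  proof (rule LIMSEQ_I)
    fix e :: real assume e: "e > 0"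
    from dom[OF \<epsilon>] obtain D where D: "\<forall>\<^sub>F t::nat in sequentially. \<forall>m. \<epsilon> * real t \<le> real m \<longrightarrow> pmf P (int m) \<le> D * pmf P (int t)"
      by blast
    \<comment> \<open>The added ones keep \<open>W\<close> positive even if \<open>D\<close> or
      \<open>U\<close> is 0, so that \<eta> is well defined; \<open>W\<close> still dominates
      \<open>\<bar>D\<bar> * U\<close>.\<close>
    define W where "W = (\<bar>D\<bar> + 1) * (U + 1)"
    have W: "W > 0" using U unfolding W_def by (intro mult_pos_pos) auto
    define \<eta> where "\<eta> = e / (2 * W)"
    have \<eta>: "\<eta> > 0" using e W by (simp add: \<eta>_def)
    from landau_o.smallD[OF R(1) \<eta>] obtain n0 where n0: "\<And>n. n \<ge> n0 \<Longrightarrow> pmf R n \<le> \<eta> * pmf P (int n)"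
      unfolding eventually_sequentially by auto
    have "\<forall>\<^sub>F t::nat in sequentially. norm ((\<integral>n. indicator (- S t) n * ?q t n \<partial>R) / pmf P (int t) - 0) < e"
      using D pos eventually_ge_at_top[of "nat \<lceil>real n0 / \<epsilon>\<rceil>"]
    proof eventually_elim
      case (elim t)
      have "(\<integral>n. indicator (- S t) n * ?q t n \<partial>R) \<le> (\<eta> * (\<bar>D\<bar> * pmf P (int t))) * U"
      proof (rule integral_nat_pmf_large_index_le)
        fix n assume n: "n \<in> - S t"
        have "real n0 / \<epsilon> \<le> real t" using elim by linarith
        then have "n \<ge> n0" using n \<epsilon> by (simp add: S_def field_simps)
        then have "pmf R n \<le> \<eta> * pmf P (int n)" by (rule n0)
        also have "\<dots> \<le> \<eta> * (\<bar>D\<bar> * pmf P (int t))"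
        proof (intro mult_left_mono)
          have "pmf P (int n) \<le> D * pmf P (int t)" using elim n by (auto simp: S_def)
          also have "\<dots> \<le> \<bar>D\<bar> * pmf P (int t)" by (intro mult_right_mono) auto
          finally show "pmf P (int n) \<le> \<bar>D\<bar> * pmf P (int t)" .
        qed (use \<eta> in auto)
        finally show "pmf R n \<le> \<eta> * (\<bar>D\<bar> * pmf P (int t))" .
      qed (use green \<eta> in auto)
      then have "(\<integral>n. indicator (- S t) n * ?q t n \<partial>R) / pmf P (int t) \<le> \<eta> * (\<bar>D\<bar> * U)"
        using elim by (simp add: field_simps)
      also have "\<dots> \<le> \<eta> * W" unfolding W_def using \<eta> U by (intro mult_left_mono mult_mono) auto
      also have "\<dots> = e / 2" using W by (simp add: \<eta>_def)
      also have "\<dots> < e" using e by simp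
      finally show ?case by (simp add: integral_nonneg)
    qed
    then show "\<exists>no. \<forall>t\<ge>no. norm ((\<integral>n. indicator (- S t) n * ?q t n \<partial>R) / pmf P (int t) - 0) < e"
      unfolding eventually_sequentially .
  qed
  have "(\<integral>n. ?q t n \<partial>R) = (\<integral>n. indicator (S t) n * ?q t n \<partial>R) + (\<integral>n. indicator (- S t) n * ?q t n \<partial>R)" for t
  proof -
    have "(\<integral>n. ?q t n \<partial>R) = (\<integral>n. indicator (S t) n * ?q t n + indicator (- S t) n * ?q t n \<partial>R)"
      by (intro Bochner_Integration.integral_cong) (auto simp: indicator_def)
    also have "\<dots> = (\<integral>n. indicator (S t) n * ?q t n \<partial>R) + (\<integral>n. indicator (- S t) n * ?q t n \<partial>R)"
      by (intro Bochner_Integration.integral_add integrable_bounded_pmf[of _ 1]) (auto simp: indicator_def pmf_le_1)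
    finally show ?thesis .
  qed
  with tendsto_add[OF bulk large] show ?thesis by (simp add: add_divide_distrib)
qed

section \<open>From random variables to their laws\<close>

context prob_space
begin

text \<open>On a countable type a law is carried by its atoms.\<close>

lemma distr_count_space_eq_pmf:
  fixes Y :: "'a \<Rightarrow> 'b :: countable"
  assumes Y: "Y \<in> M \<rightarrow>\<^sub>M count_space UNIV"
  shows "\<exists>P. measure_pmf P = distr M (count_space UNIV) Y"
proof -
  let ?D = "distr M (count_space UNIV) Y"
  interpret D: prob_space ?D by (rule prob_space_distr) fact
  have "AE y in ?D. measure ?D {y} \<noteq> 0"
    by (subst D.AE_support_countable) (auto intro!: exI[of _ UNIV])
  then have "measure_pmf (Abs_pmf ?D) = ?D"
    by (intro Abs_pmf_inverse) (auto simp: D.prob_space_axioms)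
  then show ?thesis ..
qed

lemma
  assumes Y[measurable]: "Y \<in> M \<rightarrow>\<^sub>M count_space UNIV" and P: "measure_pmf P = distr M (count_space UNIV) Y"
  shows measure_pmf_distr: "measure P A = prob {\<omega> \<in> space M. Y \<omega> \<in> A}"
    and pmf_distr: "pmf P y = prob {\<omega> \<in> space M. Y \<omega> = y}"
proof -
  show *: "measure P A = prob {\<omega> \<in> space M. Y \<omega> \<in> A}" for A
    unfolding P by (subst measure_distr) (auto intro!: arg_cong[where f = prob])
  show "pmf P y = prob {\<omega> \<in> space M. Y \<omega> = y}"
    by (simp add: * pmf.rep_eq)
qed

text \<open>The last variable \<open>X n\<close> plays the part of the first factor of the
  convolution; this is legitimate because every \<open>X i\<close> has law \<open>P\<close>.\<close>

lemma prob_partial_sum_eq_walk_pmf: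
  fixes X :: "nat \<Rightarrow> 'a \<Rightarrow> int"
  assumes iid: "iid_int_seq X" and P: "measure_pmf P = distr M (count_space UNIV) (X 0)"
  shows "prob {\<omega> \<in> space M. (\<Sum>i<n. X i \<omega>) = t} = pmf (walk_pmf P n) t"
proof (induction n arbitrary: t)
  case 0
  then show ?case by (cases "t = 0") (auto simp: pmf_return prob_space)
next
  case (Suc n)
  have indep: "indep_vars (\<lambda>_. count_space UNIV) X UNIV"
    and id: "\<And>i. distr M (count_space UNIV) (X i) = measure_pmf P"
    using iid P by (auto simp: iid_int_seq_def)
  have X[measurable]: "X i \<in> M \<rightarrow>\<^sub>M count_space UNIV" for i
    using indep by (auto simp: indep_vars_def)
  have marg: "prob {\<omega> \<in> space M. X i \<omega> = x} = pmf P x" for i x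
    by (rule pmf_distr[symmetric]) (use X id in auto)
  define S where "S \<omega> = (\<Sum>i<n. X i \<omega>)" for \<omega>
  \<comment> \<open>Independence of \<open>X n\<close> and the partial sum is obtained for
    real-valued copies; the embedding is injective, so the integer events are unchanged.\<close>
  have "indep_vars (\<lambda>_. borel) (\<lambda>i \<omega>. real_of_int (X i \<omega>)) UNIV"
    by (rule indep_vars_compose2[OF indep]) simp
  then have "indep_var borel (\<lambda>\<omega>. real_of_int (X n \<omega>)) borel (\<lambda>\<omega>. \<Sum>i\<in>{..<n}. real_of_int (X i \<omega>))"
    by (intro indep_vars_sum) (auto intro: indep_vars_subset)
  then have ind: "indep_var borel (\<lambda>\<omega>. real_of_int (X n \<omega>)) borel (\<lambda>\<omega>. real_of_int (S \<omega>))"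
    by (simp add: S_def)
  have joint: "prob {\<omega> \<in> space M. X n \<omega> = x \<and> S \<omega> = t - x} = pmf P x * pmf (walk_pmf P n) (t - x)" for x
  proof -
    have "prob {\<omega> \<in> space M. X n \<omega> = x \<and> S \<omega> = t - x}
      = prob ((\<lambda>\<omega>. (real_of_int (X n \<omega>), real_of_int (S \<omega>))) -` ({real_of_int x} \<times> {real_of_int (t - x)}) \<inter> space M)"
      by (intro arg_cong[where f = prob]) auto
    also have "\<dots> = prob ((\<lambda>\<omega>. real_of_int (X n \<omega>)) -` {real_of_int x} \<inter> space M)
        * prob ((\<lambda>\<omega>. real_of_int (S \<omega>)) -` {real_of_int (t - x)} \<inter> space M)"
      by (rule indep_varD[OF ind]) auto
    also have "(\<lambda>\<omega>. real_of_int (X n \<omega>)) -` {real_of_int x} \<inter> space M = {\<omega> \<in> space M. X n \<omega> = x}" by auto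
    also have "(\<lambda>\<omega>. real_of_int (S \<omega>)) -` {real_of_int (t - x)} \<inter> space M = {\<omega> \<in> space M. S \<omega> = t - x}"
      by (simp only: vimage_def of_int_eq_iff singleton_iff) auto
    finally show ?thesis using Suc[of "t - x"] marg[of n x] by (simp add: S_def)
  qed
  have [measurable]: "(\<lambda>\<omega>. real_of_int (S \<omega>)) \<in> borel_measurable M" unfolding S_def by simp
  have sets: "{\<omega> \<in> space M. X n \<omega> = x \<and> S \<omega> = t - x} \<in> events" for x
  proof -
    have "{\<omega> \<in> space M. X n \<omega> = x \<and> real_of_int (S \<omega>) = real_of_int (t - x)} \<in> events" by measurable
    then show ?thesis by (simp only: of_int_eq_iff)
  qed
  have "ennreal (prob {\<omega> \<in> space M. (\<Sum>i<Suc n. X i \<omega>) = t})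
      = emeasure M (\<Union>x. {\<omega> \<in> space M. X n \<omega> = x \<and> S \<omega> = t - x})"
    unfolding emeasure_eq_measure S_def by (intro arg_cong[where f = ennreal] arg_cong[where f = prob]) auto
  also have "\<dots> = (\<integral>\<^sup>+x. emeasure M {\<omega> \<in> space M. X n \<omega> = x \<and> S \<omega> = t - x} \<partial>count_space UNIV)"
    by (rule emeasure_UN_countable) (use sets in \<open>auto simp: disjoint_family_on_def\<close>)
  also have "\<dots> = (\<integral>\<^sup>+x. ennreal (pmf (walk_pmf P n) (t - x)) \<partial>P)"
    by (simp add: emeasure_eq_measure joint nn_integral_measure_pmf ennreal_mult)
  also have "\<dots> = ennreal (\<integral>x. pmf (walk_pmf P n) (t - x) \<partial>P)"
    by (intro nn_integral_eq_integral integrable_bounded_pmf[of _ 1]) (auto simp: pmf_le_1)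
  finally show ?case by (simp add: pmf_conv_pmf integral_nonneg)
qed

lemma prob_random_sum_eq:
  fixes X :: "nat \<Rightarrow> 'a \<Rightarrow> int" and N :: "'a \<Rightarrow> nat"
  assumes iid: "iid_int_seq X" and P: "measure_pmf P = distr M (count_space UNIV) (X 0)"
    and N[measurable]: "N \<in> M \<rightarrow>\<^sub>M count_space UNIV" and indepN: "indep_of_int_seq N X"
    and R: "\<And>n. pmf R n = prob {\<omega> \<in> space M. N \<omega> = n}"
  shows "prob {\<omega> \<in> space M. random_sum X N \<omega> = t} = (\<integral>n. pmf (walk_pmf P n) t \<partial>R)"
proof -
  have X[measurable]: "X i \<in> M \<rightarrow>\<^sub>M count_space UNIV" for i
    using iid by (auto simp: iid_int_seq_def indep_vars_def)
  have joint: "prob ({\<omega> \<in> space M. N \<omega> = n} \<inter> {\<omega> \<in> space M. (\<Sum>i<n. X i \<omega>) = t}) = pmf R n * pmf (walk_pmf P n) t"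
    and sets: "{\<omega> \<in> space M. N \<omega> = n} \<inter> {\<omega> \<in> space M. (\<Sum>i<n. X i \<omega>) = t} \<in> events" for n
  proof -
    let ?V = "vimage_algebra (space M) (\<lambda>\<omega> i. X i \<omega>) (\<Pi>\<^sub>M i\<in>UNIV. count_space UNIV)"
    \<comment> \<open>The event about the first \<open>n\<close> variables is the preimage of a
      measurable set of sequences, so it lies in the sigma-algebra that is independent of
      \<open>N\<close>.\<close>
    let ?A = "{f \<in> space (\<Pi>\<^sub>M i\<in>(UNIV :: nat set). count_space (UNIV :: int set)). (\<Sum>i<n. real_of_int (f i)) = real_of_int t}"
    have A: "?A \<in> sets (\<Pi>\<^sub>M i\<in>UNIV. count_space UNIV)" by measurable
    have "(\<lambda>\<omega> i. X i \<omega>) -` ?A \<inter> space M \<in> sets ?V"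
      using A by (rule in_vimage_algebra)
    also have "(\<lambda>\<omega> i. X i \<omega>) -` ?A \<inter> space M = {\<omega> \<in> space M. (\<Sum>i<n. X i \<omega>) = t}"
      by (simp only: of_int_sum[symmetric] of_int_eq_iff) (auto simp: space_PiM)
    finally have V: "{\<omega> \<in> space M. (\<Sum>i<n. X i \<omega>) = t} \<in> sets ?V" .
    have "N -` {n} \<inter> space M \<in> sets (vimage_algebra (space M) N (count_space UNIV))"
      by (rule in_vimage_algebra) simp
    also have "N -` {n} \<inter> space M = {\<omega> \<in> space M. N \<omega> = n}" by auto
    finally have W: "{\<omega> \<in> space M. N \<omega> = n} \<in> sets (vimage_algebra (space M) N (count_space UNIV))" .
    note ind = indepN[unfolded indep_of_int_seq_def]
    show "prob ({\<omega> \<in> space M. N \<omega> = n} \<inter> {\<omega> \<in> space M. (\<Sum>i<n. X i \<omega>) = t}) = pmf R n * pmf (walk_pmf P n) t"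
      using indep_setD[OF ind W V] by (simp add: R prob_partial_sum_eq_walk_pmf[OF iid P])
    show "{\<omega> \<in> space M. N \<omega> = n} \<inter> {\<omega> \<in> space M. (\<Sum>i<n. X i \<omega>) = t} \<in> events"
      using indep_setD_ev1[OF ind] indep_setD_ev2[OF ind] V W by (intro sets.Int) auto
  qed
  have "ennreal (prob {\<omega> \<in> space M. random_sum X N \<omega> = t})
      = emeasure M (\<Union>n. {\<omega> \<in> space M. N \<omega> = n} \<inter> {\<omega> \<in> space M. (\<Sum>i<n. X i \<omega>) = t})"
    unfolding emeasure_eq_measure random_sum_def
    by (intro arg_cong[where f = ennreal] arg_cong[where f = prob]) auto
  also have "\<dots> = (\<integral>\<^sup>+n. emeasure M ({\<omega> \<in> space M. N \<omega> = n} \<inter> {\<omega> \<in> space M. (\<Sum>i<n. X i \<omega>) = t}) \<partial>count_space UNIV)"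
    by (rule emeasure_UN_countable) (use sets in \<open>auto simp: disjoint_family_on_def\<close>)
  also have "\<dots> = (\<integral>\<^sup>+n. ennreal (pmf (walk_pmf P n) t) \<partial>R)"
    by (simp add: emeasure_eq_measure joint nn_integral_measure_pmf ennreal_mult)
  also have "\<dots> = ennreal (\<integral>n. pmf (walk_pmf P n) t \<partial>R)"
    by (intro nn_integral_eq_integral integrable_bounded_pmf[of _ 1]) (auto simp: pmf_le_1)
  finally show ?thesis by (simp add: integral_nonneg)
qed

end

section \<open>Moments, bounds and limit for the laws of \<open>X 0\<close> and
  \<open>N\<close>\<close>

theorem theorem4:
  fixes M :: "'a measure" and X :: "nat \<Rightarrow> 'a \<Rightarrow> int" and N :: "'a \<Rightarrow> nat"
    and L\<^sub>1 :: "real \<Rightarrow> real" and \<alpha> :: real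
  assumes "prob_space M"
    and "prob_space.iid_int_seq M X"
    and "N \<in> M \<rightarrow>\<^sub>M count_space UNIV"
    and "prob_space.indep_of_int_seq M N X"
    and "2 < \<alpha>" and "\<alpha> < 3"
    and "\<And>t::nat. t \<ge> 1 \<Longrightarrow>
           measure M {\<omega> \<in> space M. X 0 \<omega> = int t} = real t powr (-\<alpha>) * L\<^sub>1 (real t)"
    and "slowly_varying L\<^sub>1"
    and "(\<lambda>t::real. L\<^sub>1 (t * L\<^sub>1 t powr (1 / (\<alpha> - 1)))) \<sim>[at_top] L\<^sub>1"
    and "(\<integral>\<omega>. real_of_int (X 0 \<omega>) \<partial>M) > 0"
    and "(\<lambda>t::nat. measure M {\<omega> \<in> space M. X 0 \<omega> < - int t})
           \<in> O[at_top](\<lambda>t. measure M {\<omega> \<in> space M. X 0 \<omega> > int t})"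
    and "(\<lambda>t::nat. measure M {\<omega> \<in> space M. N \<omega> = t})
           \<in> o[at_top](\<lambda>t. measure M {\<omega> \<in> space M. X 0 \<omega> = int t})"
  shows "(\<lambda>t::nat. measure M {\<omega> \<in> space M. random_sum X N \<omega> = int t})
           \<sim>[at_top] (\<lambda>t. (\<integral>\<omega>. real (N \<omega>) \<partial>M) * measure M {\<omega> \<in> space M. X 0 \<omega> = int t})"
proof -
  interpret prob_space M by fact
  note iid = assms(2) and N = assms(3)
  have X[measurable]: "X i \<in> M \<rightarrow>\<^sub>M count_space UNIV" for i
    using iid by (auto simp: iid_int_seq_def indep_vars_def)
  obtain P where P: "measure_pmf P = distr M (count_space UNIV) (X 0)"
    using distr_count_space_eq_pmf[OF X[of 0]] by blast
  obtain R where R: "measure_pmf R = distr M (count_space UNIV) N"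
    using distr_count_space_eq_pmf[OF N] by blast
  note law_X = measure_pmf_distr[OF X P] pmf_distr[OF X P] and law_N = pmf_distr[OF N R]
  define p where "p t = pmf P (int t)" for t
  have p: "p t = real t powr - \<alpha> * L\<^sub>1 (real t)" if "t \<ge> 1" for t
    using assms(7) that by (simp add: p_def law_X)
  note rv = regularly_varying_pos[OF assms(8) p] regularly_varying_tendsto_shift[OF assms(8) p]
    regularly_varying_almost_decreasing[OF assms(8) p] regularly_varying_lower[OF assms(8) p]
    regularly_varying_summable[OF assms(8) p]
  have pos: "\<forall>\<^sub>F t in sequentially. 0 < pmf P (int t)" using rv(1) by (simp add: p_def)
  have long: "(\<lambda>t. pmf P (int (nat (int t - k))) / pmf P (int t)) \<longlonglongrightarrow> 1" for k
    using rv(2)[of k] by (simp add: p_def)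
  have dom: "\<exists>C. \<forall>\<^sub>F t::nat in sequentially. \<forall>m. \<delta> * real t \<le> real m \<longrightarrow> pmf P (int m) \<le> C * pmf P (int t)"
    if "\<delta> > 0" for \<delta>
    using rv(3)[OF _ that] assms(5) by (simp add: p_def)
  have low: "\<forall>\<^sub>F t::nat in sequentially. real t powr - (\<alpha> + 1) \<le> pmf P (int t)"
    using rv(4) by (simp add: p_def)
  \<comment> \<open>Because \<open>\<alpha> > 2\<close>, the exponent \<open>\<alpha> / 2\<close>
    lies strictly between 1 and \<open>\<alpha> - 1\<close>.\<close>
  have sum: "summable (\<lambda>t::nat. real t powr (\<alpha> / 2) * pmf P (int t))"
    using rv(5)[of "\<alpha> / 2"] assms(5) by (simp add: p_def)
  \<comment> \<open>The midpoint of 1 and \<open>\<alpha> / 2\<close>: the upper gap pays for the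
    passage through tails, and \<open>r - 1\<close> in \<open>(0, 1]\<close> is the exponent of the
    potential.\<close>
  define r where "r = (1 + \<alpha> / 2) / 2"
  have r: "1 < r" "r < \<alpha> / 2" "r \<le> 2" using assms(5,6) by (auto simp: r_def)
  have left: "(\<lambda>t::nat. measure P {x. x < - int t}) \<in> O(\<lambda>t. measure P {x. x > int t})"
    using assms(11) by (simp add: law_X)
  have moment: "integrable P (\<lambda>x. \<bar>real_of_int x\<bar> powr r)"
    by (rule integrable_abs_powr[OF sum left]) (use r in auto)
  have mean: "(\<integral>x. real_of_int x \<partial>P) > 0"
    using assms(10) unfolding P by (subst integral_distr) auto
  \<comment> \<open>The Bochner integral of a non-integrable function is 0 by convention, so a
    positive mean includes integrability.\<close>
  have int: "integrable P real_of_int"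
    using mean not_integrable_integral_eq by fastforce
  obtain U where U: "\<And>m t. (\<Sum>n<m. pmf (walk_pmf P n) t) \<le> U"
    by (rule walk_pmf_Green_bound[of "r - 1" P]) (use r moment int mean in auto)
  obtain \<epsilon> C where \<epsilon>: "\<epsilon> > 0"
    "\<forall>\<^sub>F t::nat in sequentially. \<forall>n. real n \<le> \<epsilon> * real t \<longrightarrow> pmf (walk_pmf P n) (int t) \<le> C * real n * pmf P (int t)"
    by (rule walk_pmf_uniform_bound[OF r(1) moment int dom _ low]) (use assms(5) in auto)
  have small: "(\<lambda>t. pmf R t) \<in> o(\<lambda>t. pmf P (int t))"
    using assms(12) by (simp add: law_X law_N)
  \<comment> \<open>Finiteness of the mean of \<open>N\<close> follows by comparison: eventually
    \<open>pmf R n <= pmf P n\<close>, and \<open>n <= n powr (\<alpha> / 2)\<close>.\<close>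
  have intR: "integrable R real"
  proof (rule integrable_nat_pmf, rule summable_comparison_test_ev)
    show "summable (\<lambda>t::nat. real t powr (\<alpha> / 2) * pmf P (int t))" by fact
    show "\<forall>\<^sub>F n in sequentially. norm (real n * pmf R n) \<le> real n powr (\<alpha> / 2) * pmf P (int n)"
      using landau_o.smallD[OF small zero_less_one] eventually_ge_at_top[of 1]
    proof eventually_elim
      case (elim n)
      have "real n powr 1 \<le> real n powr (\<alpha> / 2)" using elim assms(5) by (intro powr_mono) auto
      then show ?case using elim by (auto intro!: mult_mono)
    qed
  qed
  have lim: "(\<lambda>t. (\<integral>n. pmf (walk_pmf P n) (int t) \<partial>R) / pmf P (int t)) \<longlonglongrightarrow> (\<integral>n. real n \<partial>R)"
    by (rule tendsto_random_index[OF pos long dom U \<epsilon> small intR])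
  have EN: "(\<integral>\<omega>. real (N \<omega>) \<partial>M) = (\<integral>n. real n \<partial>R)"
    unfolding R using N by (subst integral_distr) auto
  have law: "prob {\<omega> \<in> space M. random_sum X N \<omega> = int t} = (\<integral>n. pmf (walk_pmf P n) (int t) \<partial>R)" for t
    by (rule prob_random_sum_eq[OF iid P N assms(4) law_N])
  show ?thesis
  \<comment> \<open>If the mean of \<open>N\<close> is 0, then \<open>N = 0\<close> almost surely
    and both sides vanish for \<open>t > 0\<close>; asymptotic equivalence counts 0/0 as 1.
    Otherwise the limit may be divided by the mean.\<close>
  proof (cases "(\<integral>n. real n \<partial>R) = 0")
    case True
    then have "AE n in R. real n = 0"
      using intR by (subst (asm) integral_nonneg_eq_0_iff_AE) auto
    then have "\<forall>n\<in>set_pmf R. n = 0" by (simp add: AE_measure_pmf_iff)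
    then have zero: "(\<integral>n. pmf (walk_pmf P n) (int t) \<partial>R) = 0" if "t > 0" for t :: nat
      using that by (intro integral_eq_zero_AE) (auto simp: AE_measure_pmf_iff pmf_return)
    have "\<forall>\<^sub>F t in sequentially. prob {\<omega> \<in> space M. random_sum X N \<omega> = int t}
        = (\<integral>\<omega>. real (N \<omega>) \<partial>M) * prob {\<omega> \<in> space M. X 0 \<omega> = int t}"
      using eventually_gt_at_top[of 0] by eventually_elim (simp only: law EN True zero mult_zero_left)
    then show ?thesis by (rule asymp_equiv_refl_ev)
  next
    case False
    have "(\<lambda>t. (\<integral>n. pmf (walk_pmf P n) (int t) \<partial>R)) \<sim>[at_top] (\<lambda>t. (\<integral>n. real n \<partial>R) * pmf P (int t))"
    proof (rule asymp_equivI')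
      have "(\<lambda>t. (\<integral>n. pmf (walk_pmf P n) (int t) \<partial>R) / pmf P (int t) / (\<integral>n. real n \<partial>R)) \<longlonglongrightarrow> (\<integral>n. real n \<partial>R) / (\<integral>n. real n \<partial>R)"
        by (rule tendsto_divide[OF lim tendsto_const False])
      then show "(\<lambda>t. (\<integral>n. pmf (walk_pmf P n) (int t) \<partial>R) / ((\<integral>n. real n \<partial>R) * pmf P (int t))) \<longlonglongrightarrow> 1"
        by (simp only: divide_divide_eq_left mult.commute[of "pmf P _"] divide_self[OF False])
    qed
    then show ?thesis unfolding law EN law_X(2)[symmetric] .
  qed
qed

end
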